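(* Let $q\ge5$ be a prime power with $q\not\equiv0\pmod3$. If $q\equiv1\pmod3$: $\Lambda_{\mathrm{RA},3_{\mathcal C}}=\Lambda_{\mathrm{RA},0_{\mathcal C}}=\Lambda_{\mathrm{IA},\overline{1_{\mathcal C}}}=1$; $\Pi_{3_{\mathcal C},\mathrm{RA}}=(q-1)/3$; $\Pi_{0_{\mathcal C},\mathrm{RA}}=2(q-1)/3$; $\Pi_{\overline{1_{\mathcal C}},\mathrm{IA}}=q+1$; and $\Lambda_{\mathrm{IA},3_{\mathcal C}}=\Pi_{3_{\mathcal C},\mathrm{IA}}=\Lambda_{\mathrm{IA},0_{\mathcal C}}=\Pi_{0_{\mathcal C},\mathrm{IA}}=\Lambda_{\mathrm{RA},\overline{1_{\mathcal C}}}=\Pi_{\overline{1_{\mathcal C}},\mathrm{RA}}=0$. If $q\equiv-1\pmod3$: $\Lambda_{\mathrm{IA},3_{\mathcal C}}=\Lambda_{\mathrm{IA},0_{\mathcal C}}=\Lambda_{\mathrm{RA},\overline{1_{\mathcal C}}}=1$; $\Pi_{3_{\mathcal C},\mathrm{IA}}=(q+1)/3$; $\Pi_{0_{\mathcal C},\mathrm{IA}}=2(q+1)/3$; $\Pi_{\overline{1_{\mathcal C}},\mathrm{RA}}=q-1$; and $\Lambda_{\mathrm{RA},3_{\mathcal C}}=\Pi_{3_{\mathcal C},\mathrm{RA}}=\Lambda_{\mathrm{RA},0_{\mathcal C}}=\Pi_{0_{\mathcal C},\mathrm{RA}}=\Lambda_{\mathrm{IA},\overline{1_{\mathcal C}}}=\Pi_{\overline{1_{\mathcal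 C}},\mathrm{IA}}=0$.
   Context: Let $\mathrm{PG}(3,q)$ have points $\mathbf{P}(x_0,x_1,x_2,x_3)$; put $P(t)=\mathbf{P}(t^3,t^2,t,1)$ ($t\in\mathbb{F}_q$), $P(\infty)=\mathbf{P}(1,0,0,0)$, $\mathcal{C}=\{P(t):t\in\mathbb{F}_q\cup\{\infty\}\}$ the twisted cubic, $G_q$ the group of projectivities fixing $\mathcal C$. Write $\boldsymbol{\pi}(c_0,c_1,c_2,c_3)$ for the plane $c_0x_0+c_1x_1+c_2x_2+c_3x_3=0$. The $\Gamma$-planes are the osculating planes $\boldsymbol{\pi}(1,-3t,3t^2,-t^3)$ ($t\in\mathbb{F}_q$) and $\boldsymbol{\pi}(0,0,0,1)$. A $d_{\mathcal C}$-plane ($d\in\{0,3\}$) contains exactly $d$ points of $\mathcal C$; a $\overline{1_{\mathcal C}}$-plane is a non-$\Gamma$-plane containing exactly one point of $\mathcal C$ (for $q\ge5$ each plane type is a $G_q$-orbit). An RA-line (real axis) is the intersection line of two distinct $\Gamma$-planes; an IA-line (imaginary axis) is the line of $\mathrm{PG}(3,q)$ that is the intersection of $\boldsymbol{\pi}(1,-3s,3s^2,-s^3)$ and $\boldsymbol{\pi}(1,-3s^q,3s^{2q},-s^{3q})$ for some $s\in\mathbb{F}_{q^2}\setminus\mathbb{F}_q$. Notation: $\Lambda_{\lambda,\pi}$ is the number of $\lambda$-lines in a $\pi$-plane; $\Pi_{\pi,\lambda}$ is the average, over all $\lambda$-lines, of the number of $\pi$-planes through the line. *)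

theory Defs
  imports "HOL-Analysis.Analysis"
begin

text \<open>
  The finite field of order q is a type \<open>'a::{field,finite}\<close> with \<open>q = CARD('a)\<close>.  Points, lines and
  planes of PG(3,q) are the linear subspaces of \<open>'a ^ 4\<close> of dimension 1, 2 and 3, and incidence is
  inclusion.  The homogeneous coordinates \<open>x\<^sub>0, x\<^sub>1, x\<^sub>2, x\<^sub>3\<close> are the components
  \<open>x $ 1, x $ 2, x $ 3, x $ 4\<close>.
\<close>

definition proj_lines :: "('a::field ^ 4) set set" where
  "proj_lines = {l. vec.subspace l \<and> vec.dim l = 2}"

definition proj_planes :: "('a::field ^ 4) set set" where
  "proj_planes = {p. vec.subspace p \<and> vec.dim p = 3}"

definition point :: "'a::field \<Rightarrow> 'a \<Rightarrow> 'a \<Rightarrow> 'a \<Rightarrow> ('a ^ 4) set" where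
  "point x0 x1 x2 x3 = vec.span {vector [x0, x1, x2, x3]}"

definition plane :: "'a::field \<Rightarrow> 'a \<Rightarrow> 'a \<Rightarrow> 'a \<Rightarrow> ('a ^ 4) set" where
  "plane c0 c1 c2 c3 = {x. c0 * x $ 1 + c1 * x $ 2 + c2 * x $ 3 + c3 * x $ 4 = 0}"

text \<open>The library states the component equations of \<open>vector\<close> only up to length 3.\<close>

lemma vector_4_nth [simp]:
  "(vector [w, x, y, z] :: 'a::zero ^ 4) $ 1 = w"
  "(vector [w, x, y, z] :: 'a::zero ^ 4) $ 2 = x"
  "(vector [w, x, y, z] :: 'a::zero ^ 4) $ 3 = y"
  "(vector [w, x, y, z] :: 'a::zero ^ 4) $ 4 = z"
  unfolding vector_def by simp_all

definition twisted_cubic :: "('a::field ^ 4) set set" where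
  "twisted_cubic = insert (point 1 0 0 0) (range (\<lambda>t. point (t ^ 3) (t ^ 2) t 1))"

definition osculating_plane :: "'a::field \<Rightarrow> ('a ^ 4) set" where
  "osculating_plane t = plane 1 (- 3 * t) (3 * t ^ 2) (- (t ^ 3))"

definition Gamma_planes :: "('a::field ^ 4) set set" where
  "Gamma_planes = insert (plane 0 0 0 1) (range osculating_plane)"

definition C_planes :: "nat \<Rightarrow> ('a::field ^ 4) set set" where
  "C_planes d = {p \<in> proj_planes. card {A \<in> twisted_cubic. A \<subseteq> p} = d}"

definition one_C_planes :: "('a::field ^ 4) set set" where
  "one_C_planes = C_planes 1 - Gamma_planes"

definition RA_lines :: "('a::field ^ 4) set set" where
  "RA_lines = {l \<in> proj_lines.
     \<exists>p1 \<in> Gamma_planes. \<exists>p2 \<in> Gamma_planes. p1 \<noteq> p2 \<and> l = p1 \<inter> p2}"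

text \<open>
  Imaginary axes are defined relative to an embedding \<open>\<iota>\<close> of the field of order q into the field of
  order \<open>q\<^sup>2\<close>.  The two osculating planes below live in \<open>PG(3,q\<^sup>2)\<close>; the line is regarded as a line
  of PG(3,q) by taking the vectors over the small field that lie in both.
\<close>

definition IA_lines :: "('a::{field,finite} \<Rightarrow> 'b::field) \<Rightarrow> ('a ^ 4) set set" where
  "IA_lines \<iota> = {l \<in> proj_lines. \<exists>s. s \<notin> range \<iota> \<and>
     l = {x. (\<chi> i. \<iota> (x $ i)) \<in> osculating_plane s \<inter> osculating_plane (s ^ CARD('a))}}"

text \<open>
  \<open>\<Lambda>\<close> is the number of lines of a class in a plane of another class, which makes sense when this number
  does not depend on the plane.  Hence it is rendered as a relation which asserts that there are
  planes of the class and that each of them contains exactly n of the lines.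
\<close>

definition is_Lambda :: "('a::field ^ 4) set set \<Rightarrow> ('a ^ 4) set set \<Rightarrow> nat \<Rightarrow> bool" where
  "is_Lambda L P n \<longleftrightarrow> P \<noteq> {} \<and> (\<forall>p \<in> P. card {l \<in> L. l \<subseteq> p} = n)"

definition Pi_avg :: "('a::field ^ 4) set set \<Rightarrow> ('a ^ 4) set set \<Rightarrow> real" where
  "Pi_avg P L = (\<Sum>l \<in> L. real (card {p \<in> P. l \<subseteq> p})) / real (card L)"

end

theory Submission
  imports Defs "HOL-Computational_Algebra.Polynomial" "HOL-Computational_Algebra.Primes"
begin

text \<open>
  Planes correspond to binary cubic forms up to scalars: the points of the twisted cubic in a plane are
  the roots of its form, and the \<open>\<Gamma>\<close>-planes are the cubes of linear forms.  A plane contains the axis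
  attached to a binary quadratic form \<open>Q\<close> iff its cubic form is apolar to \<open>Q\<close>, and the real
  (imaginary) axes belong to the \<open>Q\<close> with two distinct (no) roots over the small field.  A form
  that is not a cube is apolar to exactly one \<open>Q\<close> up to scalars, its Hessian; if \<open>Q\<close> has a double root
  the form has exactly two roots.  Hence every plane without exactly two points of the cubic and not
  osculating contains exactly one axis.

  Over the field of definition of its roots, a form apolar to \<open>Q\<close> is \<open>\<alpha> L\<^sub>1\<^sup>3 + \<beta> L\<^sub>2\<^sup>3\<close>, and
  \<open>L\<^sub>1 / L\<^sub>2\<close> maps the line bijectively to the roots of unity of order \<open>n = q - 1\<close> (real axis, the roots
  of \<open>Q\<close> removed) or \<open>n = q + 1\<close> (imaginary axis).  So the form has 0 or 3 roots if \<open>3\<close> divides \<open>n\<close>,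
  and at most one otherwise.  Each point of the cubic lies in exactly one of the \<open>q + 1\<close> planes through an
  axis, and this determines how many planes of each type there are.
\<close>

section \<open>Finite fields and quadratic extensions\<close>

lemma card_roots_power_le:
  fixes w :: "'a::{field,finite}"
  assumes "n > 0"
  shows "card {u. u ^ n = w} \<le> n"
proof -
  let ?p = "Polynomial.monom 1 n - [:w:]"
  have c: "Polynomial.coeff ?p n = 1"
    using assms by (cases n) auto
  hence "?p \<noteq> 0" by force
  hence "card {u. poly ?p u = 0} \<le> degree ?p" by (rule card_poly_roots_bound)
  also have "degree ?p \<le> n"
    by (intro degree_diff_le) (auto simp: degree_monom_le)
  finally show ?thesis by (simp add: poly_monom)
qed

text \<open>Multiplication by \<open>x\<close> permutes the nonzero elements, so their product is
  unchanged by the factor \<open>x ^ (CARD('a) - 1)\<close>.\<close>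

lemma finite_field_power_card:
  fixes x :: "'a::{field,finite}"
  assumes "x \<noteq> 0"
  shows "x ^ (CARD('a) - 1) = 1"
proof -
  have "(\<Prod>y\<in>UNIV - {0}. x * y) = \<Prod>(UNIV - {0})"
    by (rule prod.reindex_bij_witness[of _ "\<lambda>y. y / x" "\<lambda>y. x * y"]) (use assms in auto)
  moreover have "(\<Prod>y\<in>UNIV - {0}. x * y) = x ^ (CARD('a) - 1) * \<Prod>(UNIV - {0})"
    by (simp add: prod.distrib)
  ultimately show ?thesis by simp
qed

text \<open>The cube roots of \<open>w\<close> among the \<open>n\<close>-th roots of unity are
  either absent or a coset of the three cube roots of unity.\<close>

lemma cubes_of_roots_of_unity:
  fixes w :: "'a::{field,finite}"
  assumes n: "card {u::'a. u ^ n = 1} = n" "n > 0" and "3 dvd n"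
  shows "card {u. u ^ n = 1 \<and> u ^ 3 = w} \<in> {0, 3}"
proof (cases "\<exists>v. v ^ n = 1 \<and> v ^ 3 = w")
  case True
  then obtain v where v: "v ^ n = 1" "v ^ 3 = w" by blast
  hence v0: "v \<noteq> 0" using n by (auto simp: power_0_left)
  from \<open>3 dvd n\<close> obtain m where m: "n = 3 * m" by blast
  \<comment> \<open>Counting takes the place of cyclicity: \<open>u ^ m = 1\<close> has too few
    solutions, so some \<open>y\<close> has \<open>y ^ m\<close> of order three.\<close>
  have "card {u::'a. u ^ m = 1} \<le> m" using n m by (intro card_roots_power_le) auto
  hence "{u::'a. u ^ m = 1} \<noteq> {u. u ^ n = 1}" using n m by auto
  then obtain y :: 'a where y: "y ^ n = 1" "y ^ m \<noteq> 1"
    by (auto simp: m mult.commute[of 3] power_mult)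
  define r where "r = y ^ m"
  have r3: "r ^ 3 = 1" and r1: "r \<noteq> 1"
    using y by (auto simp: r_def m mult.commute[of 3] power_mult)
  have rn: "r ^ n = 1" using r3 by (simp add: m power_mult)
  have r0: "r \<noteq> 0" using r3 by (auto simp: power_0_left)
  have rr: "r * r \<noteq> 1" "r * r \<noteq> r"
    using r3 r1 r0 by (auto simp: power3_eq_cube)
  have "{v, r * v, r * r * v} \<subseteq> {u. u ^ n = 1 \<and> u ^ 3 = w}"
    using v r3 rn by (auto simp: power_mult_distrib)
  moreover have "card {v, r * v, r * r * v} = 3"
    using rr r1 v0 by auto
  ultimately have "3 \<le> card {u. u ^ n = 1 \<and> u ^ 3 = w}"
    by (metis card_mono finite_class.finite)
  moreover have "card {u. u ^ n = 1 \<and> u ^ 3 = w} \<le> card {u. u ^ 3 = w}"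
    by (intro card_mono) auto
  moreover have "card {u. u ^ 3 = w} \<le> 3" by (rule card_roots_power_le) simp
  ultimately show ?thesis by simp
next
  case False
  hence "{u. u ^ n = 1 \<and> u ^ 3 = w} = {}" by auto
  thus ?thesis by (simp only: card.empty) simp
qed

text \<open>Two such elements with equal cubes have a quotient \<open>y\<close> with
  \<open>y ^ 3 = 1\<close> and \<open>y ^ n = 1\<close>; as \<open>n\<close> is prime to 3,
  \<open>y = 1\<close>.\<close>

lemma cube_inj_on_roots_of_unity:
  fixes w :: "'a::{field,finite}"
  assumes "n > 0" "\<not> 3 dvd n"
  shows "card {u. u ^ n = 1 \<and> u ^ 3 = w} \<le> 1"
proof -
  have "u = v" if u: "u ^ n = 1" "v ^ n = 1" "u ^ 3 = v ^ 3" for u v :: 'a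
  proof -
    have v0: "v \<noteq> 0" using u assms by (auto simp: power_0_left)
    define y where "y = u / v"
    have yn: "y ^ n = 1" and y3: "y ^ 3 = 1"
      using u v0 by (auto simp: y_def power_divide)
    have "y ^ n = y ^ (3 * (n div 3) + n mod 3)" by simp
    also have "\<dots> = y ^ (n mod 3)" by (simp only: power_add power_mult y3) simp
    finally have e: "y ^ (n mod 3) = 1" using yn by simp
    have "n mod 3 = 1 \<or> n mod 3 = 2" using assms(2) by presburger
    hence "y = 1" using e y3 by (auto simp: power2_eq_square power3_eq_cube)
    thus ?thesis using v0 by (simp add: y_def)
  qed
  thus ?thesis by (auto simp: card_le_Suc0_iff_eq)
qed

lemma three_neq_zero:
  assumes "CARD('a::{field,finite}) mod 3 \<noteq> 0"
  shows "(3::'a) \<noteq> 0"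
proof
  assume "(3::'a) = 0"
  hence 3: "CHAR('a) dvd 3" using of_nat_eq_0_iff_char_dvd[where 'a='a, of 3] by simp
  \<comment> \<open>Translation by 1 permutes the field, so comparing sums shows that the
    characteristic divides \<open>q\<close>.\<close>
  have "(\<Sum>x\<in>(UNIV :: 'a set). x + 1) = \<Sum>UNIV"
    by (rule sum.reindex_bij_witness[of _ "\<lambda>y. y - 1" "\<lambda>y. y + 1"]) auto
  hence "of_nat CARD('a) = (0::'a)" by (simp add: sum.distrib)
  hence "CHAR('a) dvd CARD('a)" using of_nat_eq_0_iff_char_dvd by blast
  moreover have "coprime CARD('a) 3"
    using assms by (simp add: coprime_commute[of _ 3] prime_imp_coprime_nat dvd_eq_mod_eq_0)
  ultimately have "CHAR('a) = 1" using 3 by (metis coprime_common_divisor_nat nat_dvd_1_iff_1)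
  thus False using CHAR_not_1'[where 'a='a] by simp
qed

section \<open>The quadratic extension, its Frobenius map and quadratics over the base field\<close>

locale quadratic_extension =
  fixes \<iota> :: "'a::{field,finite} \<Rightarrow> 'b::{field,finite}"
  assumes ext_card: "CARD('b) = CARD('a) ^ 2"
    and emb_one: "\<iota> 1 = 1"
    and emb_add: "\<And>x y. \<iota> (x + y) = \<iota> x + \<iota> y"
    and emb_mult: "\<And>x y. \<iota> (x * y) = \<iota> x * \<iota> y"
begin

lemma emb_zero: "\<iota> 0 = 0"
proof -
  have "\<iota> 0 + \<iota> 0 = \<iota> 0 + 0" using emb_add[of 0 0] by simp
  thus ?thesis by (simp only: add_left_cancel)
qed

lemma emb_minus: "\<iota> (- x) = - \<iota> x"
  using emb_add[of x "- x"] by (simp add: emb_zero eq_neg_iff_add_eq_0 add.commute)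

lemma emb_diff: "\<iota> (x - y) = \<iota> x - \<iota> y"
  using emb_add[of x "- y"] by (simp add: emb_minus)

lemma emb_power: "\<iota> (x ^ n) = \<iota> x ^ n"
  by (induction n) (simp_all add: emb_one emb_mult)

lemma emb_numeral: "\<iota> (numeral n) = numeral n"
proof -
  have "\<iota> (of_nat k) = of_nat k" for k
    by (induction k) (simp_all add: emb_zero emb_one emb_add)
  from this[of "numeral n"] show ?thesis by simp
qed

lemma emb_eq_0_iff: "\<iota> x = 0 \<longleftrightarrow> x = 0"
proof
  assume "\<iota> x = 0"
  hence "\<iota> (x * inverse x) = 0" by (simp add: emb_mult)
  thus "x = 0" by (cases "x = 0") (auto simp: emb_one)
qed (simp add: emb_zero)

lemma emb_eq_iff: "\<iota> x = \<iota> y \<longleftrightarrow> x = y"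
  using emb_eq_0_iff[of "x - y"] by (simp add: emb_diff)

lemma emb_divide: "\<iota> (x / y) = \<iota> x / \<iota> y"
proof (cases "y = 0")
  case False
  hence "\<iota> (x / y) * \<iota> y = \<iota> x" by (simp flip: emb_mult)
  thus ?thesis using False by (simp add: emb_eq_0_iff field_simps)
qed (simp add: emb_zero)

lemmas emb_simps = emb_zero emb_one emb_add emb_mult emb_minus emb_diff emb_power emb_numeral
  emb_divide

lemma card_base_ge_2: "CARD('a) \<ge> 2"
  using card_mono[of "UNIV :: 'a set" "{0, 1}"] by simp

lemma emb_pow_card: "\<iota> a ^ CARD('a) = \<iota> a"
proof (cases "a = 0")
  case False
  have "a ^ CARD('a) = a ^ Suc (CARD('a) - 1)" by simp
  also have "\<dots> = a" unfolding power_Suc using finite_field_power_card[OF False] by simp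
  finally show ?thesis by (simp flip: emb_power)
qed (simp add: emb_zero)

text \<open>Both sides are monic polynomials of degree \<open>q\<close> in \<open>x\<close> that
  agree on the \<open>q\<close> elements of \<open>range \<iota>\<close>.\<close>

lemma pow_card_minus: "x ^ CARD('a) - x = (\<Prod>a\<in>UNIV. x - \<iota> a)"
proof -
  let ?n = "CARD('a)"
  let ?P = "Polynomial.monom 1 ?n - [:0, 1:] :: 'b poly" and ?Q = "\<Prod>a\<in>UNIV. [:- \<iota> a, 1:]"
  have n: "?n \<ge> 2" by (rule card_base_ge_2)
  have dP: "degree ?P \<le> ?n"
    using n by (intro degree_diff_le) (auto simp: degree_monom_le)
  have dQ: "degree ?Q = ?n" by (subst degree_prod_eq_sum_degree) auto
  have "lead_coeff ?Q = 1" by (simp add: lead_coeff_prod)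
  moreover have "Polynomial.coeff [:0, 1:] ?n = (0::'b)"
    using n by (intro coeff_eq_0) simp
  ultimately have lead: "Polynomial.coeff ?P ?n = Polynomial.coeff ?Q ?n"
    by (simp add: dQ del: coeff_pCons)
  have "inj \<iota>" by (auto simp: inj_def emb_eq_iff)
  hence card: "?n \<le> card (range \<iota>)" by (simp add: card_image)
  have "?P = ?Q"
  proof (rule poly_eqI_degree_lead_coeff[OF lead card dP])
    fix z assume "z \<in> range \<iota>"
    thus "poly ?P z = poly ?Q z" by (auto simp: poly_monom poly_prod emb_pow_card)
  qed (simp add: dQ)
  from arg_cong[OF this, of "\<lambda>p. poly p x"] show ?thesis
    by (simp add: poly_monom poly_prod)
qed

lemma range_emb_iff: "x \<in> range \<iota> \<longleftrightarrow> x ^ CARD('a) = x"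
proof -
  have "x ^ CARD('a) = x \<longleftrightarrow> (\<Prod>a\<in>UNIV. x - \<iota> a) = 0"
    using pow_card_minus[of x] by (metis eq_iff_diff_eq_0)
  thus ?thesis by (auto simp: emb_pow_card)
qed

text \<open>Additivity of the Frobenius map for a rational summand, read off from the translation
  invariance of the product over the base field.\<close>

lemma pow_card_add: "(x + \<iota> c) ^ CARD('a) = x ^ CARD('a) + \<iota> c"
proof -
  have "(x + \<iota> c) ^ CARD('a) - (x + \<iota> c) = (\<Prod>a\<in>UNIV. x + \<iota> c - \<iota> a)"
    by (rule pow_card_minus)
  also have "\<dots> = (\<Prod>a\<in>UNIV. x - \<iota> a)"
    by (rule prod.reindex_bij_witness[of _ "\<lambda>a. a + c" "\<lambda>a. a - c"]) (auto simp: emb_simps algebra_simps)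
  also have "\<dots> = x ^ CARD('a) - x" by (rule pow_card_minus[symmetric])
  finally show ?thesis by (simp add: algebra_simps)
qed

lemma basis_inj:
  assumes "s \<notin> range \<iota>" "\<iota> a + s * \<iota> b = \<iota> c + s * \<iota> d"
  shows "a = c \<and> b = d"
proof (cases "b = d")
  case False
  have "s * \<iota> (b - d) = \<iota> (c - a)" using assms(2) by (simp add: emb_simps algebra_simps)
  hence "s = \<iota> ((c - a) / (b - d))" using False by (simp add: emb_simps emb_eq_iff field_simps)
  thus ?thesis using assms(1) by blast
qed (use assms(2) in \<open>simp add: emb_eq_iff\<close>)

lemma basis_exists:
  assumes "s \<notin> range \<iota>"
  obtains a b where "z = \<iota> a + s * \<iota> b"
proof -
  let ?g = "\<lambda>(a, b). \<iota> a + s * \<iota> b"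
  have "inj ?g" using basis_inj[OF assms] by (auto simp: inj_def)
  moreover have "CARD('a \<times> 'a) = CARD('b)" by (simp add: ext_card power2_eq_square)
  ultimately have "range ?g = UNIV"
    by (metis card_image card_subset_eq finite_class.finite_UNIV subset_UNIV)
  hence "z \<in> range ?g" by simp
  thus thesis using that by auto
qed

text \<open>The Frobenius map sends \<open>s\<close> to the other root of its quadratic; the rest is
  Vieta.\<close>

lemma conjugate:
  assumes s: "s \<notin> range \<iota>" and root: "s\<^sup>2 - \<iota> T * s + \<iota> N = 0"
  shows "s ^ CARD('a) \<noteq> s" "\<iota> T = s + s ^ CARD('a)" "\<iota> N = s * s ^ CARD('a)"
proof -
  let ?n = "CARD('a)"
  show ne: "s ^ ?n \<noteq> s" using s range_emb_iff by blast
  \<comment> \<open>\<open>pow_card_add\<close> wants a rational summand, so the quadratic is solved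
    for the square first.\<close>
  have "s\<^sup>2 = \<iota> T * s + \<iota> (- N)" using root by (simp add: emb_simps algebra_simps)
  hence "(s\<^sup>2) ^ ?n = (\<iota> T * s) ^ ?n + \<iota> (- N)" by (simp only: pow_card_add)
  hence *: "(s ^ ?n)\<^sup>2 = \<iota> T * s ^ ?n - \<iota> N"
    by (simp add: power_mult_distrib emb_pow_card emb_simps flip: power_mult)
       (simp add: mult.commute)
  have "(s ^ ?n - s) * (s ^ ?n + s - \<iota> T) = 0"
  proof -
    define y where "y = s ^ ?n"
    have "y\<^sup>2 = \<iota> T * y - \<iota> N" using * by (simp only: y_def)
    hence "(y - s) * (y + s - \<iota> T) = 0" using root by algebra
    thus ?thesis by (simp only: y_def)
  qed
  thus T: "\<iota> T = s + s ^ ?n" using ne unfolding mult_eq_0_iff by (auto simp: algebra_simps)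
  show "\<iota> N = s * s ^ ?n" using root by (simp add: T algebra_simps power2_eq_square)
qed

lemma irrational_quadratic:
  assumes s: "s \<notin> range \<iota>"
  obtains T N where "s\<^sup>2 - \<iota> T * s + \<iota> N = 0"
proof -
  obtain a b where "s\<^sup>2 = \<iota> a + s * \<iota> b" using basis_exists[OF s] .
  hence "s\<^sup>2 - \<iota> b * s + \<iota> (- a) = 0" by (simp add: emb_simps)
  thus thesis using that by blast
qed

text \<open>The roots add up to \<open>T\<close>, so a rational root makes the other one rational
  too, and \<open>s\<close> is one of them.\<close>

lemma irrational_quadratic_no_root:
  assumes s: "s \<notin> range \<iota>" and root: "s\<^sup>2 - \<iota> T * s + \<iota> N = 0"
  shows "x\<^sup>2 - T * x + N \<noteq> 0"
proof
  assume "x\<^sup>2 - T * x + N = 0"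
  hence "\<iota> (x\<^sup>2 - T * x + N) = 0" by (simp add: emb_zero)
  hence "(s - \<iota> x) * (s + \<iota> x - \<iota> T) = 0"
    using root unfolding emb_simps by algebra
  hence "s = \<iota> x \<or> s = \<iota> (T - x)"
    by (simp only: emb_simps mult_eq_0_iff) (auto simp: algebra_simps)
  thus False using s by auto
qed

lemma card_quadratic_roots:
  "card {s::'b. s\<^sup>2 - t * s + m = 0} \<le> 2"
proof -
  have "card {s. poly [:m, - t, 1:] s = 0} \<le> degree [:m, - t, 1:]"
    by (rule card_poly_roots_bound) simp
  also have "poly [:m, - t, 1:] = (\<lambda>s. s\<^sup>2 - t * s + m)"
    by (auto simp: power2_eq_square algebra_simps)
  finally show ?thesis by (simp add: numeral_2_eq_2)
qed

text \<open>Sum the number of roots in the extension over all monic quadratics: every irrational element is a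
  root of some quadratic and every rational one of exactly \<open>q\<close>, so the sum is at least
  \<open>2 q\<^sup>2 - q\<close>.  The \<open>q\<close> squares have one root each, so all others must attain the bound 2.\<close>
lemma quadratic_splits:
  fixes T N :: 'a
  assumes nr: "\<And>x. x\<^sup>2 - T * x + N \<noteq> 0"
  obtains s where "s \<notin> range \<iota>" "s\<^sup>2 - \<iota> T * s + \<iota> N = 0"
proof -
  let ?n = "CARD('a)"
  define rt where "rt = (\<lambda>e::'a \<times> 'a. {s. s\<^sup>2 - \<iota> (fst e) * s + \<iota> (snd e) = 0})"
  \<comment> \<open>\<open>D\<close> collects the coefficients of the squares of linear polynomials,
    whose only root is rational.\<close>
  define D where "D = (\<lambda>x::'a. (2 * x, x\<^sup>2)) ` UNIV"
  have "rt (T, N) \<noteq> {}"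
  proof
    assume empty: "rt (T, N) = {}"
    have rtD: "rt (2 * x, x\<^sup>2) = {\<iota> x}" for x
    proof -
      have "s\<^sup>2 - \<iota> (2 * x) * s + \<iota> (x\<^sup>2) = (s - \<iota> x)\<^sup>2" for s
        by (simp add: emb_simps power2_eq_square algebra_simps)
      thus ?thesis by (simp add: rt_def)
    qed
    have "inj (\<lambda>x::'a. (2 * x, x\<^sup>2))"
    proof (rule injI)
      fix x y :: 'a assume "(2 * x, x\<^sup>2) = (2 * y, y\<^sup>2)"
      hence "{\<iota> x} = {\<iota> y}" using rtD by metis
      thus "x = y" by (simp add: emb_eq_iff)
    qed
    hence cD: "card D = ?n" by (simp add: D_def card_image)
    have TND: "(T, N) \<notin> D" using empty rtD by (auto simp: D_def)
    have le2: "card (rt e) \<le> 2" for e unfolding rt_def by (rule card_quadratic_roots)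
    have "(\<Sum>e\<in>UNIV. card (rt e)) = (\<Sum>e\<in>D. card (rt e)) + (\<Sum>e\<in>UNIV - D. card (rt e))"
      by (subst sum.subset_diff[of D]) auto
    also have "(\<Sum>e\<in>D. card (rt e)) = (\<Sum>e\<in>D. 1)"
      by (rule sum.cong) (auto simp: D_def rtD)
    also have "(\<Sum>e\<in>UNIV - D. card (rt e)) = (\<Sum>e\<in>UNIV - D - {(T, N)}. card (rt e))"
      using TND empty by (intro sum.mono_neutral_right) auto
    also have "\<dots> \<le> (\<Sum>e\<in>UNIV - D - {(T, N)}. 2)"
      by (intro sum_mono le2)
    also have "\<dots> = 2 * (?n * ?n - ?n - 1)"
      using TND by (simp add: card_Diff_subset card_Diff_singleton_if cD)
    finally have upper: "(\<Sum>e\<in>UNIV. card (rt e)) \<le> ?n + 2 * (?n * ?n - ?n - 1)"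
      by (simp add: cD)
    have "(\<Sum>e\<in>UNIV. card (rt e)) = (\<Sum>e\<in>UNIV. \<Sum>s\<in>UNIV. if s \<in> rt e then 1 else 0)"
      by (intro sum.cong) (simp_all add: sum.If_cases)
    also have "\<dots> = (\<Sum>s\<in>UNIV. \<Sum>e\<in>UNIV. if s \<in> rt e then 1 else 0)"
      by (rule sum.swap)
    also have "\<dots> = (\<Sum>s\<in>UNIV. card {e. s \<in> rt e})"
      by (intro sum.cong) (simp_all add: sum.If_cases)
    also have "\<dots> = (\<Sum>s\<in>range \<iota>. card {e. s \<in> rt e}) + (\<Sum>s\<in>UNIV - range \<iota>. card {e. s \<in> rt e})"
      by (subst sum.subset_diff[of "range \<iota>"]) auto
    also have "\<dots> \<ge> (\<Sum>s\<in>range \<iota>. ?n) + (\<Sum>s\<in>UNIV - range \<iota>. 1)"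
    proof (intro add_mono sum_mono)
      fix s assume "s \<in> range \<iota>"
      then obtain x where x: "s = \<iota> x" by blast
      have "range (\<lambda>t. (t, t * x - x\<^sup>2)) \<subseteq> {e. s \<in> rt e}"
        by (auto simp: rt_def x emb_simps)
      hence "card (range (\<lambda>t. (t, t * x - x\<^sup>2))) \<le> card {e. s \<in> rt e}"
        by (intro card_mono) auto
      moreover have "card (range (\<lambda>t. (t, t * x - x\<^sup>2))) = ?n"
        by (rule card_image) (auto simp: inj_on_def)
      ultimately show "?n \<le> card {e. s \<in> rt e}" by simp
    next
      fix s assume "s \<in> UNIV - range \<iota>"
      then obtain T' N' where "s\<^sup>2 - \<iota> T' * s + \<iota> N' = 0" using irrational_quadratic by blast
      hence "(T', N') \<in> {e. s \<in> rt e}" by (simp add: rt_def)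
      thus "1 \<le> card {e. s \<in> rt e}"
        by (metis One_nat_def Suc_leI card_gt_0_iff empty_iff finite_class.finite)
    qed
    finally have lower: "(\<Sum>e\<in>UNIV. card (rt e)) \<ge> ?n * ?n + (?n * ?n - ?n)"
    proof -
      assume a: "(\<Sum>s\<in>range \<iota>. ?n) + (\<Sum>s\<in>UNIV - range \<iota>. 1) \<le> (\<Sum>e\<in>UNIV. card (rt e))"
      have "inj \<iota>" by (auto simp: inj_def emb_eq_iff)
      hence "card (range \<iota>) = ?n" by (simp add: card_image)
      thus ?thesis using a by (simp add: card_Diff_subset ext_card power2_eq_square)
    qed
    \<comment> \<open>This keeps the natural subtractions from truncating; the rootless pair makes
      the upper bound smaller than the lower one by 2.\<close>
    have "2 * ?n \<le> ?n * ?n" using card_base_ge_2 by simp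
    thus False using upper lower card_base_ge_2 by linarith
  qed
  then obtain s where s: "s\<^sup>2 - \<iota> T * s + \<iota> N = 0" by (auto simp: rt_def)
  have "s \<notin> range \<iota>"
  proof
    assume "s \<in> range \<iota>"
    then obtain x where "s = \<iota> x" by blast
    hence "\<iota> (x\<^sup>2 - T * x + N) = 0" using s by (simp add: emb_simps)
    thus False using nr emb_eq_0_iff by blast
  qed
  thus thesis using s that by blast
qed

end

section \<open>Lines and planes\<close>

lemma mem_plane: "x \<in> plane a b c d \<longleftrightarrow> a * x $ 1 + b * x $ 2 + c * x $ 3 + d * x $ 4 = 0"
  by (simp add: plane_def)

lemma subspace_plane: "vec.subspace (plane a b c d)"
  unfolding vec.subspace_def
proof (intro conjI ballI allI)
  fix x y assume "x \<in> plane a b c d" "y \<in> plane a b c d"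
  hence "(a * x $ 1 + b * x $ 2 + c * x $ 3 + d * x $ 4)
    + (a * y $ 1 + b * y $ 2 + c * y $ 3 + d * y $ 4) = 0" by (simp add: mem_plane)
  thus "x + y \<in> plane a b c d" unfolding mem_plane by (simp add: algebra_simps)
next
  fix k x assume "x \<in> plane a b c d"
  hence "k * (a * x $ 1 + b * x $ 2 + c * x $ 3 + d * x $ 4) = 0" by (simp add: mem_plane)
  thus "k *s x \<in> plane a b c d" unfolding mem_plane by (simp add: algebra_simps)
qed (simp add: mem_plane)

text \<open>Subtracting a suitable multiple of \<open>y\<close> moves any vector of \<open>W\<close>
  into the kernel of the linear form, so \<open>y\<close> and the section span
  \<open>W\<close>.\<close>

lemma dim_plane_section:
  assumes W: "vec.subspace W" and y: "y \<in> W" "y \<notin> plane a b c d"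
  shows "vec.dim W = vec.dim (W \<inter> plane a b c d) + 1"
proof -
  let ?S = "W \<inter> plane a b c d"
  define f where "f = (\<lambda>x::'a^4. a * x $ 1 + b * x $ 2 + c * x $ 3 + d * x $ 4)"
  have S: "vec.subspace ?S" by (intro vec.subspace_inter W subspace_plane)
  hence sp: "vec.span ?S = ?S" by (rule vec.span_eq_iff[THEN iffD2])
  have fy: "f y \<noteq> 0" using y by (simp add: f_def mem_plane)
  have "x \<in> vec.span (insert y ?S)" if x: "x \<in> W" for x
  proof -
    let ?k = "f x / f y"
    have "x - ?k *s y \<in> W" using W x y by (intro vec.subspace_diff vec.subspace_scale)
    moreover have "f (x - k *s y) = f x - k * f y" for k by (simp add: f_def algebra_simps)
    hence "f (x - ?k *s y) = 0" using fy by simp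
    hence "x - ?k *s y \<in> plane a b c d" unfolding f_def mem_plane .
    ultimately have "x - ?k *s y \<in> vec.span ?S" by (simp add: sp)
    thus ?thesis unfolding vec.span_breakdown_eq by blast
  qed
  moreover have "vec.span (insert y ?S) \<subseteq> W"
    using y W by (intro vec.span_minimal) auto
  ultimately have "vec.span (insert y ?S) = W" by blast
  hence "vec.dim W = vec.dim (insert y ?S)" by (metis vec.dim_span)
  also have "\<dots> = vec.dim ?S + 1" using y by (simp add: vec.dim_insert sp)
  finally show ?thesis .
qed

lemma plane_in_proj_planes:
  assumes "a \<noteq> 0 \<or> b \<noteq> 0 \<or> c \<noteq> 0 \<or> d \<noteq> 0"
  shows "plane a b c d \<in> proj_planes"
proof -
  have "\<exists>y. y \<notin> plane a b c d"
  proof -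
    have "vector [1, 0, 0, 0] \<notin> plane a b c d \<or> vector [0, 1, 0, 0] \<notin> plane a b c d \<or>
      vector [0, 0, 1, 0] \<notin> plane a b c d \<or> vector [0, 0, 0, 1] \<notin> plane a b c d"
      using assms by (simp add: mem_plane)
    thus ?thesis by blast
  qed
  then obtain y where "y \<notin> plane a b c d" by blast
  hence "vec.dim (UNIV :: ('a^4) set) = vec.dim (UNIV \<inter> plane a b c d) + 1"
    by (intro dim_plane_section) auto
  thus ?thesis by (simp add: proj_planes_def subspace_plane card_cart_basis)
qed

text \<open>Take a linear map that kills a basis of \<open>p\<close> and sends a vector outside
  \<open>p\<close> to the first unit vector; the first row of its matrix gives the
  coefficients.\<close>

lemma proj_planeE:
  fixes p :: "('a::field ^ 4) set"
  assumes p: "p \<in> proj_planes"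
  obtains a b c d where "p = plane a b c d" "a \<noteq> 0 \<or> b \<noteq> 0 \<or> c \<noteq> 0 \<or> d \<noteq> 0"
proof -
  have sub: "vec.subspace p" and dim: "vec.dim p = 3" using p by (auto simp: proj_planes_def)
  have "p \<noteq> UNIV" using dim by (auto simp: card_cart_basis)
  then obtain y where y: "y \<notin> p" by blast
  obtain B where B: "B \<subseteq> p" "vec.independent B" "p \<subseteq> vec.span B" by (rule vec.basis_exists)
  have sB: "vec.span B = p" using B sub by (metis vec.span_mono vec.span_eq_iff subset_antisym)
  have "vec.independent (insert y B)" using B y sB by (simp add: vec.independent_insert)
  then obtain g where g: "Vector_Spaces.linear (*s) (*s) g"
    "\<And>x. x \<in> insert y B \<Longrightarrow> g x = (if x = y then axis (1::4) (1::'a) else 0)"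
    using vec.linear_independent_extend[of "insert y B" "\<lambda>x. if x = y then axis 1 1 else 0"] by blast
  have mat: "g x = matrix g *v x" for x using matrix_works[OF g(1)] by simp
  let ?m = "matrix g $ 1"
  have pl: "x \<in> plane (?m $ 1) (?m $ 2) (?m $ 3) (?m $ 4) \<longleftrightarrow> g x $ 1 = 0" for x
    by (subst mat) (simp add: mem_plane matrix_vector_mult_def sum_4)
  have ynot: "y \<notin> plane (?m $ 1) (?m $ 2) (?m $ 3) (?m $ 4)"
    unfolding pl by (simp add: g(2) axis_def)
  hence nz: "?m $ 1 \<noteq> 0 \<or> ?m $ 2 \<noteq> 0 \<or> ?m $ 3 \<noteq> 0 \<or> ?m $ 4 \<noteq> 0"
    by (auto simp: mem_plane)
  have "B \<subseteq> plane (?m $ 1) (?m $ 2) (?m $ 3) (?m $ 4)"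
    using y B(1) by (auto simp: pl g(2))
  hence sub': "p \<subseteq> plane (?m $ 1) (?m $ 2) (?m $ 3) (?m $ 4)"
    unfolding sB[symmetric] by (intro vec.span_minimal subspace_plane)
  have "p = plane (?m $ 1) (?m $ 2) (?m $ 3) (?m $ 4)"
    using plane_in_proj_planes[OF nz] dim
    by (intro vec.subspace_dim_equal sub sub' subspace_plane) (simp add: proj_planes_def)
  thus thesis using nz that by blast
qed

lemma inter_planes_in_proj_lines:
  assumes p: "p1 \<in> proj_planes" "p2 \<in> proj_planes" "p1 \<noteq> p2"
  shows "p1 \<inter> p2 \<in> proj_lines"
proof -
  have s: "vec.subspace p1" "vec.subspace p2" "vec.dim p1 = 3" "vec.dim p2 = 3"
    using p by (auto simp: proj_planes_def)
  obtain a b c d where p2: "p2 = plane a b c d" using p(2) by (rule proj_planeE)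
  have "\<not> p1 \<subseteq> p2" using vec.subspace_dim_equal[of p1 p2] s p(3) by auto
  then obtain y where "y \<in> p1" "y \<notin> p2" by blast
  hence "vec.dim p1 = vec.dim (p1 \<inter> p2) + 1"
    unfolding p2 by (intro dim_plane_section s) auto
  thus ?thesis using s by (simp add: proj_lines_def vec.subspace_inter)
qed

lemma unique_plane_through:
  assumes l: "l \<in> proj_lines" and x: "x \<notin> l"
  shows "\<exists>!p. p \<in> proj_planes \<and> l \<subseteq> p \<and> x \<in> p"
proof (rule ex1I)
  have sub: "vec.subspace l" and dim: "vec.dim l = 2" using l by (auto simp: proj_lines_def)
  hence sp: "vec.span l = l" by (simp add: vec.span_eq_iff)
  let ?p = "vec.span (insert x l)"
  have dp: "vec.dim ?p = 3" using x dim by (simp add: vec.dim_insert sp)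
  have "insert x l \<subseteq> ?p" by (rule vec.span_superset)
  thus "?p \<in> proj_planes \<and> l \<subseteq> ?p \<and> x \<in> ?p" using dp by (simp add: proj_planes_def)
  fix p assume p: "p \<in> proj_planes \<and> l \<subseteq> p \<and> x \<in> p"
  hence "?p \<subseteq> p" by (intro vec.span_minimal) (auto simp: proj_planes_def)
  thus "p = ?p" using p dp vec.subspace_dim_equal[of ?p p] by (auto simp: proj_planes_def)
qed

lemma card_option_finite: "CARD('a::finite option) = CARD('a) + 1"
  by (simp add: UNIV_option_conv card_image)

text \<open>Each plane through \<open>l\<close> meets a line skew to \<open>l\<close> in exactly one
  point, and each of the \<open>q + 1\<close> points of that line spans one plane with
  \<open>l\<close>.\<close>

lemma card_planes_through_line:
  fixes l :: "('a::{field,finite} ^ 4) set"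
  assumes l: "l \<in> proj_lines"
  shows "card {p \<in> proj_planes. l \<subseteq> p} = CARD('a) + 1"
proof -
  let ?P = "{p \<in> proj_planes. l \<subseteq> p}"
  have "l \<noteq> UNIV" using l by (auto simp: proj_lines_def card_cart_basis)
  then obtain y where y: "y \<notin> l" by blast
  from unique_plane_through[OF l y] obtain p0 where p0: "p0 \<in> ?P" "y \<in> p0" by blast
  have "p0 \<noteq> UNIV" using p0 by (auto simp: proj_planes_def card_cart_basis)
  then obtain z where z: "z \<notin> p0" by blast
  \<comment> \<open>\<open>m\<close> runs through the points of the line joining \<open>y\<close>
    and \<open>z\<close>; it misses \<open>l\<close> because \<open>y\<close> lies in
    \<open>p0\<close> but not on \<open>l\<close>, and \<open>z\<close> lies outside
    \<open>p0\<close>.\<close>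
  define m where "m = case_option y (\<lambda>k::'a. z + k *s y)"
  have ml: "m v \<notin> l" for v
  proof (cases v)
    case (Some k)
    have "z \<in> p0" if "z + k *s y \<in> l"
    proof -
      have "z + k *s y - k *s y \<in> p0"
        using that p0 by (intro vec.subspace_diff vec.subspace_scale) (auto simp: proj_planes_def)
      thus ?thesis by simp
    qed
    thus ?thesis using z Some by (auto simp: m_def)
  qed (use y in \<open>simp add: m_def\<close>)
  have ex: "\<exists>!v. m v \<in> p" if p: "p \<in> ?P" for p
  proof -
    have "p \<in> proj_planes" using p by simp
    then obtain a b c d where pl: "p = plane a b c d" by (rule proj_planeE)
    define f where "f = (\<lambda>x::'a^4. a * x $ 1 + b * x $ 2 + c * x $ 3 + d * x $ 4)"
    have mem: "x \<in> p \<longleftrightarrow> f x = 0" for x by (simp add: pl f_def mem_plane)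
    have f: "f (z + k *s y) = f z + k * f y" for k by (simp add: f_def algebra_simps)
    show ?thesis
    proof (cases "y \<in> p")
      case True
      hence "p = p0" using unique_plane_through[OF l y] p p0 by blast
      hence "z \<notin> p" using z by simp
      hence "m v \<in> p \<longleftrightarrow> v = None" for v
        using True by (cases v) (auto simp: m_def mem f)
      thus ?thesis by blast
    next
      case False
      hence fy: "f y \<noteq> 0" by (simp add: mem)
      have k: "f z + k * f y = 0 \<longleftrightarrow> k = - f z / f y" for k
        unfolding nonzero_eq_divide_eq[OF fy] by (metis add.commute eq_neg_iff_add_eq_0)
      have "m v \<in> p \<longleftrightarrow> v = Some (- f z / f y)" for v
        by (cases v) (simp_all add: m_def mem f k fy)
      thus ?thesis by simp
    qed
  qed
  have ex': "\<exists>!p. p \<in> ?P \<and> m v \<in> p" for v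
    using unique_plane_through[OF l ml[of v]] by blast
  define g where "g = (\<lambda>v. THE p. p \<in> ?P \<and> m v \<in> p)"
  have g: "g v \<in> ?P" "m v \<in> g v" for v
    using theI'[OF ex'[of v]] by (auto simp: g_def)
  have "inj g"
    by (rule injI) (metis ex g)
  moreover have "range g = ?P"
  proof (intro equalityI subsetI)
    fix p assume p: "p \<in> ?P"
    then obtain v where "m v \<in> p" using ex by blast
    hence "g v = p" using ex'[of v] g[of v] p by blast
    thus "p \<in> range g" by blast
  qed (use g in auto)
  ultimately have "card ?P = CARD('a option)" by (metis card_image)
  thus ?thesis by (simp add: card_option_finite)
qed

section \<open>The twisted cubic and its axes\<close>

text \<open>The parameter \<open>None\<close> stands for \<open>\<infinity>\<close>; \<open>(hx v, hy v)\<close> are homogeneous coordinates of \<open>v\<close>.\<close>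

definition hx :: "'a::field option \<Rightarrow> 'a" where "hx = case_option 1 id"
definition hy :: "'a::field option \<Rightarrow> 'a" where "hy = case_option 0 (\<lambda>_. 1)"

lemma h_simps [simp]: "hx None = 1" "hx (Some t) = t" "hy None = 0" "hy (Some t) = 1"
  by (simp_all add: hx_def hy_def)

definition cubic_form :: "'a::field \<Rightarrow> 'a \<Rightarrow> 'a \<Rightarrow> 'a \<Rightarrow> 'a \<Rightarrow> 'a \<Rightarrow> 'a" where
  "cubic_form a b c d x y = a * x ^ 3 + b * x\<^sup>2 * y + c * x * y\<^sup>2 + d * y ^ 3"

definition cubic_pt :: "'a::field option \<Rightarrow> 'a ^ 4" where
  "cubic_pt v = vector [hx v ^ 3, (hx v)\<^sup>2 * hy v, hx v * (hy v)\<^sup>2, hy v ^ 3]"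

definition gamma :: "'a::field option \<Rightarrow> ('a ^ 4) set" where
  "gamma = case_option (plane 0 0 0 1) osculating_plane"

lemma cubic_pt_in_plane: "cubic_pt v \<in> plane a b c d \<longleftrightarrow> cubic_form a b c d (hx v) (hy v) = 0"
  by (simp add: mem_plane cubic_pt_def cubic_form_def mult.assoc)

lemma twisted_cubic_eq: "twisted_cubic = range (\<lambda>v. vec.span {cubic_pt v})"
  unfolding twisted_cubic_def point_def UNIV_option_conv
  by (auto simp: cubic_pt_def image_image)

lemma Gamma_planes_eq: "Gamma_planes = range gamma"
  unfolding Gamma_planes_def UNIV_option_conv by (auto simp: gamma_def image_image)

lemma inj_cubic_span: "inj (\<lambda>v. vec.span {cubic_pt v :: 'a::field ^ 4})"
proof (rule injI)
  fix v w :: "'a option"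
  assume "vec.span {cubic_pt v} = vec.span {cubic_pt w}"
  hence "cubic_pt v \<in> vec.span {cubic_pt w}" by (metis vec.span_base singletonI)
  then obtain k where k: "cubic_pt v = k *s cubic_pt w"
    by (auto simp: vec.span_singleton)
  have "cubic_pt v $ i = k * cubic_pt w $ i" for i using k by simp
  from this[of 1] this[of 2] this[of 3] this[of 4] show "v = w"
    by (cases v; cases w) (auto simp: cubic_pt_def)
qed

lemma card_cubic_points:
  assumes "vec.subspace p"
  shows "card {A \<in> twisted_cubic. A \<subseteq> p} = card {v. cubic_pt v \<in> p}"
proof -
  have "vec.span {x} \<subseteq> p \<longleftrightarrow> x \<in> p" for x
    using assms vec.span_minimal[of "{x}" p] vec.span_base[of x "{x}"] by blast
  hence "{A \<in> twisted_cubic. A \<subseteq> p} = (\<lambda>v. vec.span {cubic_pt v}) ` {v. cubic_pt v \<in> p}"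
    by (auto simp: twisted_cubic_eq)
  thus ?thesis using card_image[OF inj_on_subset[OF inj_cubic_span subset_UNIV]] by simp
qed

lemma gamma_in_proj_planes: "gamma v \<in> proj_planes"
  by (cases v) (auto simp: gamma_def osculating_plane_def intro!: plane_in_proj_planes)

text \<open>The form of an osculating plane is the cube of the linear form that vanishes at its
  parameter, \<open>y ^ 3\<close> at infinity.\<close>

lemma cubic_pt_in_gamma: "cubic_pt v \<in> gamma w \<longleftrightarrow> v = w"
proof (cases w)
  case (Some t)
  have "cubic_form 1 (- 3 * t) (3 * t\<^sup>2) (- (t ^ 3)) x y = (x - t * y) ^ 3" for x y
    by (simp add: cubic_form_def algebra_simps power2_eq_square power3_eq_cube)
  thus ?thesis using Some
    by (cases v) (auto simp: gamma_def osculating_plane_def cubic_pt_in_plane)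
qed (cases v; simp add: gamma_def cubic_pt_in_plane cubic_form_def)

lemma inj_gamma: "gamma v = gamma w \<longleftrightarrow> v = w"
  using cubic_pt_in_gamma by metis

text \<open>Apolarity of \<open>(A, B, C)\<close> to the cubic with binomial coefficients \<open>(a, b / 3, c / 3, d)\<close>,
  multiplied by 3.  The roots of the quadratic form are the solutions of \<open>A + B s + C s\<^sup>2 = 0\<close>.\<close>

definition apolar :: "'a::field \<Rightarrow> 'a \<Rightarrow> 'a \<Rightarrow> 'a \<Rightarrow> 'a \<Rightarrow> 'a \<Rightarrow> 'a \<Rightarrow> bool" where
  "apolar A B C a b c d \<longleftrightarrow> 3 * A * a - B * b + C * c = 0 \<and> - A * b + B * c - 3 * C * d = 0"

definition axis_of :: "('a::field ^ 4) set \<Rightarrow> 'a \<Rightarrow> 'a \<Rightarrow> 'a \<Rightarrow> bool" where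
  "axis_of l A B C \<longleftrightarrow> l \<in> proj_lines \<and> (\<forall>a b c d. l \<subseteq> plane a b c d \<longleftrightarrow> apolar A B C a b c d)"

text \<open>\<open>T\<close> and \<open>N\<close> are the sum and the product of the two parameters of the osculating planes, so that
  conjugate pairs in the extension need no separate treatment; \<open>inf_axis t\<close> has the parameters
  \<open>\<infinity>\<close> and \<open>t\<close>.\<close>

definition fin_axis :: "'a::field \<Rightarrow> 'a \<Rightarrow> ('a ^ 4) set" where
  "fin_axis T N = {x. x $ 1 = 3 * N * x $ 3 - T * N * x $ 4 \<and> 3 * x $ 2 = 3 * T * x $ 3 - (T\<^sup>2 - N) * x $ 4}"

definition inf_axis :: "'a::field \<Rightarrow> ('a ^ 4) set" where
  "inf_axis t = {x. x $ 4 = 0 \<and> x $ 1 = 3 * t * x $ 2 - 3 * t\<^sup>2 * x $ 3}"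

lemma osculating_inter:
  fixes s t :: "'a::field"
  assumes "s \<noteq> t"
  shows "osculating_plane s \<inter> osculating_plane t = fin_axis (s + t) (s * t)"
proof (rule set_eqI)
  fix x :: "'a ^ 4"
  define e where "e = (\<lambda>r::'a. x $ 1 - 3 * r * x $ 2 + 3 * r\<^sup>2 * x $ 3 - r ^ 3 * x $ 4)"
  \<comment> \<open>\<open>f\<close> and \<open>g\<close> are the two equations of the axis. Since
    \<open>e s = f - s * g\<close> and \<open>e t = f - t * g\<close> with \<open>s\<close> and
    \<open>t\<close> distinct, both \<open>e\<close> vanish only if \<open>f\<close> and
    \<open>g\<close> do.\<close>
  define f where "f = x $ 1 - 3 * s * t * x $ 3 + (s + t) * (s * t) * x $ 4"
  define g where "g = 3 * x $ 2 - 3 * (s + t) * x $ 3 + ((s + t)\<^sup>2 - s * t) * x $ 4"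
  have "x \<in> osculating_plane r \<longleftrightarrow> e r = 0" for r
    by (simp add: osculating_plane_def mem_plane e_def algebra_simps)
  moreover have "x \<in> fin_axis (s + t) (s * t) \<longleftrightarrow> f = 0 \<and> g = 0"
    by (simp add: fin_axis_def f_def g_def algebra_simps)
  moreover have "e s = f - s * g" "e t = f - t * g"
    by (simp_all add: e_def f_def g_def algebra_simps power2_eq_square power3_eq_cube)
  moreover have "f - s * g = 0 \<and> f - t * g = 0 \<longleftrightarrow> f = 0 \<and> g = 0"
  proof
    assume *: "f - s * g = 0 \<and> f - t * g = 0"
    hence "(s - t) * g = 0" by algebra
    thus "f = 0 \<and> g = 0" using * assms by simp
  qed auto
  ultimately show "x \<in> osculating_plane s \<inter> osculating_plane t \<longleftrightarrow> x \<in> fin_axis (s + t) (s * t)"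
    by simp
qed

lemma osculating_inter_inf: "plane 0 0 0 1 \<inter> osculating_plane t = inf_axis t"
  by (auto simp: osculating_plane_def mem_plane inf_axis_def algebra_simps)

lemma axis_of_fin_axis:
  assumes 3: "(3::'a::field) \<noteq> 0"
  shows "axis_of (fin_axis T N :: ('a ^ 4) set) N (- T) 1"
  unfolding axis_of_def
proof (intro conjI allI)
  let ?p = "plane 1 0 (- 3 * N) (T * N)" and ?p' = "plane 0 3 (- 3 * T) (T\<^sup>2 - N)"
  have "vector [0, 1, 0, 0] \<in> ?p" "vector [0, 1, 0, 0] \<notin> ?p'" using 3 by (simp_all add: mem_plane)
  hence "?p \<noteq> ?p'" by blast
  hence "?p \<inter> ?p' \<in> proj_lines"
    using 3 by (intro inter_planes_in_proj_lines plane_in_proj_planes) auto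
  moreover have "fin_axis T N = ?p \<inter> ?p'"
    by (auto simp: fin_axis_def mem_plane algebra_simps)
  ultimately show "fin_axis T N \<in> proj_lines" by simp
next
  fix a b c d :: 'a
  show "fin_axis T N \<subseteq> plane a b c d \<longleftrightarrow> apolar N (- T) 1 a b c d"
  proof
    assume sub: "fin_axis T N \<subseteq> plane a b c d"
    \<comment> \<open>Two vectors that span the axis, one with \<open>x $ 4 = 0\<close> and one with
      \<open>x $ 3 = 0\<close>, turn containment into two equations.\<close>
    have "vector [3 * N, T, 1, 0] \<in> fin_axis T N" by (simp add: fin_axis_def)
    hence "vector [3 * N, T, 1, 0] \<in> plane a b c d" using sub by blast
    hence 1: "3 * N * a + T * b + c = 0" by (simp add: mem_plane mult.commute)
    define e where "e = (T\<^sup>2 - N) / 3"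
    have e: "3 * e = T\<^sup>2 - N" using 3 by (simp add: e_def)
    have "vector [- T * N, - e, 0, 1] \<in> fin_axis T N" by (simp add: fin_axis_def e)
    hence "vector [- T * N, - e, 0, 1] \<in> plane a b c d" using sub by blast
    hence "a * (- T * N) + b * (- e) + d = 0" by (simp add: mem_plane)
    with 1 e have "- N * b - T * c - 3 * d = 0" by algebra
    thus "apolar N (- T) 1 a b c d" using 1 by (simp add: apolar_def)
  next
    assume "apolar N (- T) 1 a b c d"
    hence ap: "3 * N * a + T * b + c = 0" "- N * b - T * c - 3 * d = 0" by (simp_all add: apolar_def)
    show "fin_axis T N \<subseteq> plane a b c d"
    proof
      fix x assume "x \<in> fin_axis T N"
      hence x: "x $ 1 = 3 * N * x $ 3 - T * N * x $ 4"
        "3 * x $ 2 = 3 * T * x $ 3 - (T\<^sup>2 - N) * x $ 4" by (simp_all add: fin_axis_def)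
      have "3 * (a * x $ 1 + b * x $ 2 + c * x $ 3 + d * x $ 4) = 0"
        using x ap by algebra
      thus "x \<in> plane a b c d" using 3 unfolding mem_plane mult_eq_0_iff by blast
    qed
  qed
qed

text \<open>The quadratic \<open>t - s\<close> has leading coefficient 0: its roots are
  \<open>t\<close> and infinity.\<close>

lemma axis_of_inf_axis:
  "axis_of (inf_axis t :: ('a::field ^ 4) set) t (- 1) 0"
  unfolding axis_of_def
proof (intro conjI allI)
  have "gamma None \<inter> gamma (Some t) \<in> proj_lines"
    by (intro inter_planes_in_proj_lines gamma_in_proj_planes) (simp add: inj_gamma)
  thus "inf_axis t \<in> proj_lines" by (simp add: gamma_def osculating_inter_inf)
next
  fix a b c d :: 'a
  show "inf_axis t \<subseteq> plane a b c d \<longleftrightarrow> apolar t (- 1) 0 a b c d"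
  proof
    assume sub: "inf_axis t \<subseteq> plane a b c d"
    have "vector [3 * t, 1, 0, 0] \<in> inf_axis t" "vector [- 3 * t\<^sup>2, 0, 1, 0] \<in> inf_axis t"
      by (simp_all add: inf_axis_def)
    hence "vector [3 * t, 1, 0, 0] \<in> plane a b c d" "vector [- 3 * t\<^sup>2, 0, 1, 0] \<in> plane a b c d"
      using sub by blast+
    hence "3 * t * a + b = 0" "- 3 * t\<^sup>2 * a + c = 0" by (simp_all add: mem_plane mult.commute)
    moreover from this have "- t * b - c = 0" by algebra
    ultimately show "apolar t (- 1) 0 a b c d" by (simp add: apolar_def)
  next
    assume "apolar t (- 1) 0 a b c d"
    hence ap: "3 * t * a + b = 0" "- t * b - c = 0" by (simp_all add: apolar_def)
    show "inf_axis t \<subseteq> plane a b c d"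
    proof
      fix x assume "x \<in> inf_axis t"
      hence "x $ 4 = 0" "x $ 1 = 3 * t * x $ 2 - 3 * t\<^sup>2 * x $ 3" by (simp_all add: inf_axis_def)
      hence "a * x $ 1 + b * x $ 2 + c * x $ 3 + d * x $ 4 = 0" using ap by algebra
      thus "x \<in> plane a b c d" by (simp add: mem_plane)
    qed
  qed
qed

lemma RA_lines_eq:
  "(RA_lines :: ('a::field ^ 4) set set) = {fin_axis (s + t) (s * t) | s t. s \<noteq> t} \<union> range inf_axis"
proof -
  have "(RA_lines :: ('a ^ 4) set set) = {gamma v \<inter> gamma w | v w. v \<noteq> w}"
    by (auto simp: RA_lines_def Gamma_planes_eq inj_gamma
        intro!: inter_planes_in_proj_lines gamma_in_proj_planes)
  also have "\<dots> = {fin_axis (s + t) (s * t) | s t. s \<noteq> t} \<union> range inf_axis" (is "?L = ?R")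
  proof (intro equalityI subsetI)
    fix l assume "l \<in> ?L"
    then obtain v w where vw: "l = gamma v \<inter> gamma w" "v \<noteq> w" by blast
    thus "l \<in> ?R"
      by (cases v; cases w)
        (auto simp: gamma_def osculating_inter_inf osculating_inter Int_commute[of "osculating_plane _" "plane 0 0 0 1"])
  next
    fix l :: "('a ^ 4) set" assume "l \<in> ?R"
    then consider s t where "l = fin_axis (s + t) (s * t)" "s \<noteq> t" | t where "l = inf_axis t" by blast
    thus "l \<in> ?L"
    proof cases
      case 1
      hence "l = gamma (Some s) \<inter> gamma (Some t)" by (simp add: gamma_def osculating_inter)
      thus ?thesis using 1 by blast
    next
      case 2
      hence "l = gamma None \<inter> gamma (Some t)" by (simp add: gamma_def osculating_inter_inf)
      thus ?thesis by blast
    qed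
  qed
  finally show ?thesis .
qed

context quadratic_extension
begin

text \<open>Trace and norm of \<open>s\<close> are rational, so the intersection over the extension
  has equations over the base field. Conversely, every quadratic without rational roots has a root
  in the extension.\<close>

lemma IA_lines_eq:
  assumes 3: "(3::'a) \<noteq> 0"
  shows "IA_lines \<iota> = {fin_axis T N | T N. \<forall>x. x\<^sup>2 - T * x + N \<noteq> 0}"
proof -
  have ax: "{x. (\<chi> i. \<iota> (x $ i)) \<in> osculating_plane s \<inter> osculating_plane (s ^ CARD('a))} = fin_axis T N"
    if s: "s \<notin> range \<iota>" "s\<^sup>2 - \<iota> T * s + \<iota> N = 0" for s T N
  proof -
    note c = conjugate[OF s]
    have "(\<chi> i. \<iota> (x $ i)) \<in> fin_axis (\<iota> T) (\<iota> N) \<longleftrightarrow> x \<in> fin_axis T N" for x :: "'a ^ 4"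
    proof -
      have "(\<chi> i. \<iota> (x $ i)) \<in> fin_axis (\<iota> T) (\<iota> N) \<longleftrightarrow>
        \<iota> (x $ 1) = \<iota> (3 * N * x $ 3 - T * N * x $ 4) \<and>
        \<iota> (3 * x $ 2) = \<iota> (3 * T * x $ 3 - (T\<^sup>2 - N) * x $ 4)"
        by (simp add: fin_axis_def emb_simps)
      thus ?thesis by (simp add: fin_axis_def emb_eq_iff)
    qed
    moreover have "osculating_plane s \<inter> osculating_plane (s ^ CARD('a)) = fin_axis (\<iota> T) (\<iota> N)"
      using osculating_inter[of s "s ^ CARD('a)"] c by metis
    ultimately show ?thesis by simp
  qed
  show ?thesis
  proof (intro equalityI subsetI)
    fix l assume "l \<in> IA_lines \<iota>"
    then obtain s where s: "s \<notin> range \<iota>"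
      "l = {x. (\<chi> i. \<iota> (x $ i)) \<in> osculating_plane s \<inter> osculating_plane (s ^ CARD('a))}"
      unfolding IA_lines_def by blast
    obtain T N where TN: "s\<^sup>2 - \<iota> T * s + \<iota> N = 0" using irrational_quadratic[OF s(1)] .
    have "l = fin_axis T N" using ax[OF s(1) TN] s(2) by simp
    thus "l \<in> {fin_axis T N | T N. \<forall>x. x\<^sup>2 - T * x + N \<noteq> 0}"
      using irrational_quadratic_no_root[OF s(1) TN] by blast
  next
    fix l assume "l \<in> {fin_axis T N | T N. \<forall>x::'a. x\<^sup>2 - T * x + N \<noteq> 0}"
    then obtain T N where l: "l = fin_axis T N" "\<And>x::'a. x\<^sup>2 - T * x + N \<noteq> 0" by blast
    obtain s where s: "s \<notin> range \<iota>" "s\<^sup>2 - \<iota> T * s + \<iota> N = 0" using quadratic_splits[OF l(2)] .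
    have "l \<in> proj_lines" using axis_of_fin_axis[OF 3] l by (simp add: axis_of_def)
    thus "l \<in> IA_lines \<iota>" unfolding IA_lines_def using ax[OF s] l(1) s(1) by blast
  qed
qed

end

section \<open>Points of the cubic, sums of two cubes, and counts in the pencil of an axis\<close>

lemma cubic_pt_not_in_inf_axis: "cubic_pt v \<notin> inf_axis t"
  by (cases v) (auto simp: cubic_pt_def inf_axis_def)

text \<open>A point of the cubic lies in an osculating plane only at its own parameter, so the
  quadratic must have a rational double root. The discriminant then excludes real axes, and the root
  excludes imaginary ones.\<close>

lemma cubic_pt_in_fin_axis:
  assumes "cubic_pt v \<in> fin_axis T N"
  obtains u where "u\<^sup>2 - T * u + N = 0" "T\<^sup>2 - 4 * N = 0"
proof (cases v)
  case None
  thus thesis using assms by (simp add: cubic_pt_def fin_axis_def)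
next
  case (Some u)
  define r where "r = u\<^sup>2 - T * u + N"
  have c: "u ^ 3 = 3 * N * u - T * N" "3 * u\<^sup>2 = 3 * T * u - (T\<^sup>2 - N)"
    using assms by (simp_all add: Some cubic_pt_def fin_axis_def)
  \<comment> \<open>The left side is the first equation of the axis minus \<open>u\<close> times the
    second.\<close>
  have "r * (T - 2 * u) = 0" using c unfolding r_def by algebra
  moreover have "r = 0" if "T = 2 * u"
    using c that unfolding r_def by algebra
  ultimately have "r = 0" by auto
  moreover have "T\<^sup>2 - 4 * N = 0" using c \<open>r = 0\<close> unfolding r_def by algebra
  ultimately show thesis using that by (simp add: r_def)
qed

lemma sum_cubic_points_through_line:
  fixes l :: "('a::{field,finite} ^ 4) set"
  assumes l: "l \<in> proj_lines" and no: "\<And>v. cubic_pt v \<notin> l"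
  shows "(\<Sum>p | p \<in> proj_planes \<and> l \<subseteq> p. card {v. cubic_pt v \<in> p}) = CARD('a) + 1"
proof -
  let ?P = "{p \<in> proj_planes. l \<subseteq> p}"
  have "(\<Sum>p\<in>?P. card {v. cubic_pt v \<in> p}) = (\<Sum>p\<in>?P. \<Sum>v\<in>UNIV. if cubic_pt v \<in> p then 1 else 0)"
    by (intro sum.cong) (simp_all add: sum.If_cases)
  also have "\<dots> = (\<Sum>v\<in>UNIV. \<Sum>p\<in>?P. if cubic_pt v \<in> p then 1 else 0)"
    by (rule sum.swap)
  also have "\<dots> = (\<Sum>v\<in>(UNIV :: 'a option set). 1)"
  proof (rule sum.cong)
    fix v :: "'a option"
    have "card {p \<in> ?P. cubic_pt v \<in> p} = 1"
      using unique_plane_through[OF l no[of v]] by (simp add: card_1_singleton_iff) blast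
    thus "(\<Sum>p\<in>?P. if cubic_pt v \<in> p then 1 else 0) = (1::nat)"
      by (simp add: sum.If_cases Int_def)
  qed simp
  finally show ?thesis by (simp add: card_option_finite)
qed

lemma card_cubic_points_gamma: "card {v. cubic_pt v \<in> gamma w} = 1"
  by (simp add: cubic_pt_in_gamma)

text \<open>If the form is \<open>\<alpha> L\<^sub>1\<^sup>3 + \<beta> L\<^sub>2\<^sup>3\<close>, its roots are the points where
  \<open>z = L\<^sub>1 / L\<^sub>2\<close> satisfies \<open>z\<^sup>3 = - \<beta> / \<alpha>\<close>; injectivity of \<open>z\<close> and the bound on the number of
  roots of unity turn \<open>z\<close> into a bijection onto the \<open>n\<close>-th roots of unity.\<close>
lemma card_roots_sum_of_cubes:
  fixes \<iota> :: "'a::{field,finite} \<Rightarrow> 'b::{field,finite}"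
  assumes \<iota>: "\<iota> 0 = 0" "\<iota> 1 = 1" "inj \<iota>"
    and det: "a1 * b2 - a2 * b1 \<noteq> 0"
    and L1: "\<And>v. L1 v = a1 * \<iota> (hx v) + b1 * \<iota> (hy v)"
    and L2: "\<And>v. L2 v = a2 * \<iota> (hx v) + b2 * \<iota> (hy v)"
    and root: "\<And>v. v \<in> Z \<longleftrightarrow> \<alpha> * L1 v ^ 3 + \<beta> * L2 v ^ 3 = 0"
    and nz: "\<alpha> \<noteq> 0" "\<beta> \<noteq> 0"
    and n: "card {v. L1 v \<noteq> 0 \<and> L2 v \<noteq> 0} = n" "n > 0"
    and unity: "\<And>v. L1 v \<noteq> 0 \<Longrightarrow> L2 v \<noteq> 0 \<Longrightarrow> L1 v ^ n = L2 v ^ n"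
  shows "3 dvd n \<Longrightarrow> card Z \<in> {0, 3}" "\<not> 3 dvd n \<Longrightarrow> card Z \<le> 1"
proof -
  define R where "R = {v. L1 v \<noteq> 0 \<and> L2 v \<noteq> 0}"
  define z where "z = (\<lambda>v. L1 v / L2 v)"
  \<comment> \<open>Injectivity of \<open>z\<close> in multiplied-out form, which also covers zeros
    of \<open>L2\<close>; it rests on the multiplicativity of 2 by 2 determinants.\<close>
  have cross: "L1 v * L2 w = L1 w * L2 v \<longleftrightarrow> v = w" for v w
  proof -
    have "L1 v * L2 w - L1 w * L2 v =
      (a1 * b2 - a2 * b1) * (\<iota> (hx v) * \<iota> (hy w) - \<iota> (hx w) * \<iota> (hy v))"
      by (simp add: L1 L2 algebra_simps)
    moreover have "\<iota> (hx v) * \<iota> (hy w) - \<iota> (hx w) * \<iota> (hy v) = 0 \<longleftrightarrow> v = w"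
      using \<iota> by (cases v; cases w) (auto simp: inj_eq)
    ultimately show ?thesis using det by (metis eq_iff_diff_eq_0 mult_eq_0_iff)
  qed
  have inj: "inj_on z R"
    by (rule inj_onI) (use cross in \<open>auto simp: z_def R_def frac_eq_eq\<close>)
  have sub: "z ` R \<subseteq> {u. u ^ n = 1}"
    using unity by (auto simp: z_def R_def power_divide)
  have "card (z ` R) = n" using inj n by (simp add: card_image R_def)
  moreover have "card {u::'b. u ^ n = 1} \<le> n" by (rule card_roots_power_le) fact
  ultimately have cn: "card {u::'b. u ^ n = 1} = n" and im: "z ` R = {u. u ^ n = 1}"
    using card_mono[OF _ sub] card_subset_eq[OF _ sub] by simp_all
  have not_both: "L1 v \<noteq> 0 \<or> L2 v \<noteq> 0" for v
  proof (rule ccontr)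
    assume "\<not> ?thesis"
    hence "v = w" for w using cross[of v w] by simp
    from this[of None] this[of "Some 0"] show False by simp
  qed
  have "v \<in> Z \<longleftrightarrow> v \<in> R \<and> z v ^ 3 = - \<beta> / \<alpha>" for v
  proof (cases "v \<in> R")
    case True
    hence "z v ^ 3 = - \<beta> / \<alpha> \<longleftrightarrow> \<alpha> * L1 v ^ 3 = - \<beta> * L2 v ^ 3"
      using nz frac_eq_eq[of "L2 v ^ 3" \<alpha> "L1 v ^ 3" "- \<beta>"]
      unfolding z_def R_def power_divide by (simp add: mult.commute)
    also have "\<dots> \<longleftrightarrow> v \<in> Z" unfolding root by (simp add: eq_neg_iff_add_eq_0)
    finally show ?thesis using True by simp
  next
    case False
    hence "L1 v = 0 \<and> L2 v \<noteq> 0 \<or> L1 v \<noteq> 0 \<and> L2 v = 0" using not_both[of v] by (auto simp: R_def)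
    thus ?thesis using nz False by (auto simp: root)
  qed
  hence Z: "Z = {v \<in> R. z v ^ 3 = - \<beta> / \<alpha>}" by blast
  have "z ` Z = {u. u ^ n = 1 \<and> u ^ 3 = - \<beta> / \<alpha>}"
    using im by (auto simp: Z)
  moreover have "inj_on z Z" using inj by (rule inj_on_subset) (auto simp: Z)
  ultimately have card: "card Z = card {u. u ^ n = 1 \<and> u ^ 3 = - \<beta> / \<alpha>}"
    by (metis card_image)
  show "card Z \<in> {0, 3}" if "3 dvd n"
    unfolding card using cn n(2) that by (rule cubes_of_roots_of_unity)
  show "card Z \<le> 1" if "\<not> 3 dvd n"
    unfolding card using n(2) that by (rule cube_inj_on_roots_of_unity)
qed

text \<open>The forms apolar to a quadratic with distinct roots are spanned by the cubes of its
  factors: \<open>a\<close> and \<open>b\<close> determine \<alpha> and \<beta>, and the apolarity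
  conditions then fix \<open>c\<close> and \<open>d\<close>.\<close>

lemma apolar_sum_of_cubes:
  fixes a b c d s t :: "'a::field"
  assumes 3: "(3::'a) \<noteq> 0" and st: "s \<noteq> t" and ap: "apolar (s * t) (- (s + t)) 1 a b c d"
  obtains \<alpha> \<beta> where "a = \<alpha> + \<beta>" "b = - 3 * (\<alpha> * s + \<beta> * t)"
    "c = 3 * (\<alpha> * s\<^sup>2 + \<beta> * t\<^sup>2)" "d = - (\<alpha> * s ^ 3 + \<beta> * t ^ 3)"
    "\<And>x y. cubic_form a b c d x y = \<alpha> * (x - s * y) ^ 3 + \<beta> * (x - t * y) ^ 3"
proof -
  \<comment> \<open>Cramer's rule for \<open>a = \<alpha> + \<beta>\<close> and
    \<open>- b / 3 = \<alpha> * s + \<beta> * t\<close>.\<close>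
  define m \<alpha> \<beta> where "m = b / 3" and "\<alpha> = (- m - t * a) / (s - t)" and "\<beta> = (s * a + m) / (s - t)"
  have b: "b = 3 * m" using 3 by (simp add: m_def)
  have al: "\<alpha> * (s - t) = - m - t * a" and be: "\<beta> * (s - t) = s * a + m"
    using st by (simp_all add: \<alpha>_def \<beta>_def)
  have cd: "3 * (s * t) * a - - (s + t) * b + 1 * c = 0"
    "- (s * t) * b + - (s + t) * c - 3 * 1 * d = 0"
    using ap unfolding apolar_def by blast+
  have "(s - t) * (a - \<alpha> - \<beta>) = 0" using al be by algebra
  hence a: "a = \<alpha> + \<beta>" using st unfolding mult_eq_0_iff by (auto simp: algebra_simps)
  have "(s - t) * (m + \<alpha> * s + \<beta> * t) = 0" using al be by algebra
  hence m: "m = - (\<alpha> * s + \<beta> * t)" using st unfolding mult_eq_0_iff by (simp add: eq_neg_iff_add_eq_0 add.assoc del: minus_add_distrib)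
  have c: "c = 3 * (\<alpha> * s\<^sup>2 + \<beta> * t\<^sup>2)" using cd a b m by algebra
  have "3 * (d + (\<alpha> * s ^ 3 + \<beta> * t ^ 3)) = 0" using cd a b m c by algebra
  hence d: "d = - (\<alpha> * s ^ 3 + \<beta> * t ^ 3)" 
    using 3 unfolding mult_eq_0_iff by (simp add: eq_neg_iff_add_eq_0 del: minus_add_distrib)
  have b': "b = - 3 * (\<alpha> * s + \<beta> * t)" using b m by algebra
  have "cubic_form a b c d x y = \<alpha> * (x - s * y) ^ 3 + \<beta> * (x - t * y) ^ 3" for x y
    unfolding cubic_form_def a b' c d by algebra
  thus thesis using a b' c d that by blast
qed

text \<open>\<open>n\<close> is \<open>q - 1\<close> for real axes and \<open>q + 1\<close> for imaginary ones.\<close>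

definition axis_order :: "('a::{field,finite} ^ 4) set \<Rightarrow> nat \<Rightarrow> bool" where
  "axis_order l n \<longleftrightarrow> l \<in> proj_lines \<and> (\<forall>v. cubic_pt v \<notin> l) \<and>
     card {w. l \<subseteq> gamma w} + n = CARD('a) + 1 \<and>
     (\<forall>p \<in> proj_planes - Gamma_planes. l \<subseteq> p \<longrightarrow>
        (3 dvd n \<longrightarrow> card {v. cubic_pt v \<in> p} \<in> {0, 3}) \<and>
        (\<not> 3 dvd n \<longrightarrow> card {v. cubic_pt v \<in> p} \<le> 1))"

lemma C_planes_eq: "C_planes d = {p \<in> proj_planes. card {v. cubic_pt v \<in> p} = d}"
  unfolding C_planes_def using card_cubic_points by (auto simp: proj_planes_def)

text \<open>Every osculating plane through \<open>l\<close> takes up one plane and one point, so the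
  remaining \<open>n\<close> planes contain \<open>n\<close> points in total. If the values are 0
  and 3, a third of these planes take the value 3; if they are at most 1, all take the value
  1.\<close>

lemma axis_order_counts:
  fixes l :: "('a::{field,finite} ^ 4) set"
  assumes "axis_order l n"
  shows "3 dvd n \<Longrightarrow> 3 * card {p \<in> C_planes 3. l \<subseteq> p} = n"
    and "3 dvd n \<Longrightarrow> 3 * card {p \<in> C_planes 0. l \<subseteq> p} = 2 * n"
    and "3 dvd n \<Longrightarrow> {p \<in> one_C_planes. l \<subseteq> p} = {}"
    and "\<not> 3 dvd n \<Longrightarrow> {p \<in> C_planes 3. l \<subseteq> p} = {}"
    and "\<not> 3 dvd n \<Longrightarrow> {p \<in> C_planes 0. l \<subseteq> p} = {}"
    and "\<not> 3 dvd n \<Longrightarrow> card {p \<in> one_C_planes. l \<subseteq> p} = n"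
proof -
  define k where "k = (\<lambda>p::('a ^ 4) set. card {v. cubic_pt v \<in> p})"
  define P where "P = {p \<in> proj_planes. l \<subseteq> p}"
  define S where "S = P - Gamma_planes"
  have l: "l \<in> proj_lines" and no: "\<And>v. cubic_pt v \<notin> l"
    and g: "card {w. l \<subseteq> gamma w} + n = CARD('a) + 1"
    using assms by (auto simp: axis_order_def)
  have per: "3 dvd n \<Longrightarrow> k p = 0 \<or> k p = 3" "\<not> 3 dvd n \<Longrightarrow> k p \<le> 1" if "p \<in> S" for p
    using assms that by (auto simp: axis_order_def k_def S_def P_def)
  have PG: "P \<inter> Gamma_planes = gamma ` {w. l \<subseteq> gamma w}"
    by (auto simp: P_def Gamma_planes_eq gamma_in_proj_planes)
  have cPG: "card (P \<inter> Gamma_planes) = card {w. l \<subseteq> gamma w}"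
    unfolding PG by (rule card_image) (simp add: inj_on_def inj_gamma)
  have S_un: "P = S \<union> (P \<inter> Gamma_planes)" "S \<inter> (P \<inter> Gamma_planes) = {}" by (auto simp: S_def)
  have kG: "k p = 1" if "p \<in> Gamma_planes" for p
    using that by (auto simp: Gamma_planes_eq k_def card_cubic_points_gamma)
  have "card P = card S + card (P \<inter> Gamma_planes)"
    by (subst S_un(1)) (rule card_Un_disjoint, use S_un(2) in auto)
  moreover have "card P = CARD('a) + 1"
    unfolding P_def by (rule card_planes_through_line[OF l])
  ultimately have cS: "card S = n" using g cPG by simp
  have "sum k P = sum k S + sum k (P \<inter> Gamma_planes)"
    by (subst S_un(1)) (rule sum.union_disjoint, use S_un(2) in auto)
  moreover have "sum k (P \<inter> Gamma_planes) = card (P \<inter> Gamma_planes)"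
    using kG by simp
  moreover have "sum k P = CARD('a) + 1"
    unfolding P_def k_def using sum_cubic_points_through_line[OF l no] .
  ultimately have kS: "sum k S = n" using g cPG by simp
  \<comment> \<open>Osculating planes contain exactly one point, so leaving them out changes nothing
    for \<open>d \<noteq> 1\<close>; for \<open>d = 1\<close> they are removed in
    \<open>one_C_planes\<close>.\<close>
  have C: "{p \<in> C_planes d. l \<subseteq> p} = {p \<in> S. k p = d}" if "d \<noteq> 1" for d
    using that kG by (auto simp: C_planes_eq S_def P_def k_def)
  have C1: "{p \<in> one_C_planes. l \<subseteq> p} = {p \<in> S. k p = 1}"
    by (auto simp: one_C_planes_def C_planes_eq S_def P_def k_def)
  {
    assume n: "3 dvd n"
    have "sum k S = (\<Sum>p\<in>S. if k p = 3 then 3 else 0)"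
      using per(1)[OF _ n] by (intro sum.cong) auto
    also have "\<dots> = 3 * card {p \<in> S. k p = 3}"
      by (simp add: sum.If_cases Int_def)
    finally have 3: "3 * card {p \<in> S. k p = 3} = n" using kS by simp
    thus "3 * card {p \<in> C_planes 3. l \<subseteq> p} = n" by (simp add: C)
    have "S = {p \<in> S. k p = 3} \<union> {p \<in> S. k p = 0}" using per(1)[OF _ n] by blast
    hence "card S = card ({p \<in> S. k p = 3} \<union> {p \<in> S. k p = 0})" by simp
    also have "\<dots> = card {p \<in> S. k p = 3} + card {p \<in> S. k p = 0}"
      by (rule card_Un_disjoint) auto
    finally show "3 * card {p \<in> C_planes 0. l \<subseteq> p} = 2 * n" using 3 cS by (simp add: C)
    show "{p \<in> one_C_planes. l \<subseteq> p} = {}" unfolding C1 using per(1)[OF _ n] by fastforce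
  }
  {
    assume n: "\<not> 3 dvd n"
    have "k p = 1" if "p \<in> S" for p
      using sum_mono_inv[of k S "\<lambda>_. 1"] per(2)[OF _ n] that kS cS by simp
    thus "{p \<in> C_planes 3. l \<subseteq> p} = {}" "{p \<in> C_planes 0. l \<subseteq> p} = {}"
      "card {p \<in> one_C_planes. l \<subseteq> p} = n" unfolding C1 using cS
      by (auto simp: C cong: conj_cong)
  }
qed

section \<open>Planes through an axis\<close>

lemma plane_scale:
  assumes "(k::'a::field) \<noteq> 0"
  shows "plane (k * a) (k * b) (k * c) (k * d) = plane a b c d"
proof -
  have "k * a * x $ 1 + k * b * x $ 2 + k * c * x $ 3 + k * d * x $ 4
    = k * (a * x $ 1 + b * x $ 2 + c * x $ 3 + d * x $ 4)" for x :: "'a ^ 4"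
    by (simp add: algebra_simps)
  thus ?thesis using assms by (auto simp: plane_def)
qed

lemma gamma_plane: "gamma (Some t) = plane 1 (- 3 * t) (3 * t\<^sup>2) (- (t ^ 3))" "gamma None = plane 0 0 0 1"
  by (simp_all add: gamma_def osculating_plane_def)

lemma osculating_planeI:
  assumes "k \<noteq> 0" "a = k" "b = - 3 * t * k" "c = 3 * t\<^sup>2 * k" "d = - (t ^ 3) * k"
  shows "plane a b c d \<in> Gamma_planes"
proof -
  have "plane a b c d = gamma (Some t)"
    using plane_scale[OF assms(1), of 1 "- 3 * t" "3 * t\<^sup>2" "- (t ^ 3)"]
    by (simp add: assms gamma_plane mult_ac)
  thus ?thesis by (simp add: Gamma_planes_eq)
qed

lemma osculating_plane_infI:
  assumes "(d::'a::field) \<noteq> 0"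
  shows "plane 0 0 0 d \<in> Gamma_planes"
  using plane_scale[OF assms, of 0 0 0 1] by (simp add: Gamma_planes_eq flip: gamma_plane)

text \<open>A quadratic is apolar to the cube of a linear form iff it vanishes at the root of that
  form. The leading coefficient is 1 here, so infinity is no root.\<close>

lemma fin_axis_subset_gamma:
  assumes 3: "(3::'a::field) \<noteq> 0"
  shows "fin_axis T N \<subseteq> gamma w \<longleftrightarrow> (\<exists>u::'a. w = Some u \<and> u\<^sup>2 - T * u + N = 0)"
proof -
  note ax = axis_of_fin_axis[OF 3, of T N, unfolded axis_of_def, THEN conjunct2, rule_format]
  show ?thesis
  proof (cases w)
    case None
    thus ?thesis using 3 by (simp add: gamma_plane ax apolar_def)
  next
    case (Some u)
    have "apolar N (- T) 1 1 (- 3 * u) (3 * u\<^sup>2) (- (u ^ 3)) \<longleftrightarrow>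
        3 * (u\<^sup>2 - T * u + N) = 0 \<and> 3 * u * (u\<^sup>2 - T * u + N) = 0"
      unfolding apolar_def by (simp add: algebra_simps power2_eq_square power3_eq_cube)
    also have "\<dots> \<longleftrightarrow> u\<^sup>2 - T * u + N = 0" using 3 unfolding mult_eq_0_iff by blast
    finally show ?thesis using Some by (simp add: gamma_plane ax)
  qed
qed

lemma inf_axis_subset_gamma:
  assumes 3: "(3::'a::field) \<noteq> 0"
  shows "inf_axis t \<subseteq> gamma w \<longleftrightarrow> w = None \<or> w = Some (t::'a)"
proof -
  note ax = axis_of_inf_axis[of t, unfolded axis_of_def, THEN conjunct2, rule_format]
  show ?thesis
  proof (cases w)
    case None
    thus ?thesis by (simp add: gamma_plane ax apolar_def)
  next
    case (Some u)
    have "apolar t (- 1) 0 1 (- 3 * u) (3 * u\<^sup>2) (- (u ^ 3)) \<longleftrightarrow>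
        3 * (t - u) = 0 \<and> 3 * u * (t - u) = 0"
      unfolding apolar_def by (simp add: algebra_simps power2_eq_square power3_eq_cube)
    also have "\<dots> \<longleftrightarrow> u = t" using 3 unfolding mult_eq_0_iff by auto
    finally show ?thesis using Some by (simp add: gamma_plane ax)
  qed
qed

text \<open>Off their zeros both linear forms take nonzero values in the base field, where every
  \<open>(q - 1)\<close>-th power is 1.\<close>

lemma axis_order_fin_axis_real:
  fixes s t :: "'a::{field,finite}"
  assumes 3: "(3::'a) \<noteq> 0" and st: "s \<noteq> t" and q: "CARD('a) > 1"
  shows "axis_order (fin_axis (s + t) (s * t)) (CARD('a) - 1)"
  unfolding axis_order_def
proof (intro conjI allI ballI impI)
  let ?l = "fin_axis (s + t) (s * t)" and ?n = "CARD('a) - 1"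
  have ax: "axis_of ?l (s * t) (- (s + t)) 1" by (rule axis_of_fin_axis[OF 3])
  thus "?l \<in> proj_lines" by (simp add: axis_of_def)
  show "cubic_pt v \<notin> ?l" for v
  proof
    assume "cubic_pt v \<in> ?l"
    then obtain u where "(s + t)\<^sup>2 - 4 * (s * t) = 0" by (rule cubic_pt_in_fin_axis)
    hence "(s - t)\<^sup>2 = 0" by algebra
    thus False using st by simp
  qed
  have "u\<^sup>2 - (s + t) * u + s * t = (u - s) * (u - t)" for u
    by (simp add: algebra_simps power2_eq_square)
  hence "{w. ?l \<subseteq> gamma w} = {Some s, Some t}"
    by (auto simp: fin_axis_subset_gamma[OF 3])
  thus "card {w. ?l \<subseteq> gamma w} + ?n = CARD('a) + 1"
    using st q by simp
  fix p assume p: "p \<in> proj_planes - Gamma_planes" and sub: "?l \<subseteq> p"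
  hence "p \<in> proj_planes" by simp
  then obtain a b c d where pl: "p = plane a b c d" "a \<noteq> 0 \<or> b \<noteq> 0 \<or> c \<noteq> 0 \<or> d \<noteq> 0"
    by (rule proj_planeE)
  have "apolar (s * t) (- (s + t)) 1 a b c d" using ax sub pl(1) by (simp add: axis_of_def)
  then obtain \<alpha> \<beta> where ab: "a = \<alpha> + \<beta>" "b = - 3 * (\<alpha> * s + \<beta> * t)"
    "c = 3 * (\<alpha> * s\<^sup>2 + \<beta> * t\<^sup>2)" "d = - (\<alpha> * s ^ 3 + \<beta> * t ^ 3)"
    and form: "\<And>x y. cubic_form a b c d x y = \<alpha> * (x - s * y) ^ 3 + \<beta> * (x - t * y) ^ 3"
    by (rule apolar_sum_of_cubes[OF 3 st]) blast
  \<comment> \<open>A vanishing coefficient leaves a single cube, the form of an osculating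
    plane.\<close>
  have "\<alpha> \<noteq> 0"
  proof
    assume "\<alpha> = 0"
    hence "plane a b c d \<in> Gamma_planes"
      using ab pl(2) by (intro osculating_planeI[of \<beta> _ _ t]) auto
    thus False using p pl(1) by simp
  qed
  moreover have "\<beta> \<noteq> 0"
  proof
    assume "\<beta> = 0"
    hence "plane a b c d \<in> Gamma_planes"
      using ab pl(2) by (intro osculating_planeI[of \<alpha> _ _ s]) auto
    thus False using p pl(1) by simp
  qed
  \<comment> \<open>\<open>id\<close> plays the role of the embedding, as the factors are already
    rational.\<close>
  moreover define L1 where "L1 = (\<lambda>v. 1 * id (hx v) + (- s) * id (hy v))"
  moreover define L2 where "L2 = (\<lambda>v. 1 * id (hx v) + (- t) * id (hy v))"
  moreover have "v \<in> {v. cubic_pt v \<in> p} \<longleftrightarrow> \<alpha> * L1 v ^ 3 + \<beta> * L2 v ^ 3 = 0" for v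
    by (simp add: pl cubic_pt_in_plane form L1_def L2_def)
  moreover have "card {v. L1 v \<noteq> 0 \<and> L2 v \<noteq> 0} = ?n"
  proof -
    have "L1 v = 0 \<longleftrightarrow> v = Some s" "L2 v = 0 \<longleftrightarrow> v = Some t" for v
      by (cases v; auto simp: L1_def L2_def)+
    hence "{v. L1 v \<noteq> 0 \<and> L2 v \<noteq> 0} = UNIV - {Some s, Some t}" by auto
    thus ?thesis using st by (simp add: card_Diff_subset card_option_finite)
  qed
  moreover have "L1 v ^ ?n = L2 v ^ ?n" if "L1 v \<noteq> 0" "L2 v \<noteq> 0" for v
    using that finite_field_power_card by metis
  ultimately show "3 dvd ?n \<Longrightarrow> card {v. cubic_pt v \<in> p} \<in> {0, 3}"
    and "\<not> 3 dvd ?n \<Longrightarrow> card {v. cubic_pt v \<in> p} \<le> 1"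
    using card_roots_sum_of_cubes[of id 1 "- t" 1 "- s" L1 L2 "{v. cubic_pt v \<in> p}" \<alpha> \<beta> ?n] st q
    by simp_all
qed

lemma axis_order_inf_axis:
  fixes t :: "'a::{field,finite}"
  assumes 3: "(3::'a) \<noteq> 0" and q: "CARD('a) > 1"
  shows "axis_order (inf_axis t) (CARD('a) - 1)"
  unfolding axis_order_def
proof (intro conjI allI ballI impI)
  let ?l = "inf_axis t" and ?n = "CARD('a) - 1"
  have ax: "axis_of ?l t (- 1) 0" by (rule axis_of_inf_axis)
  thus "?l \<in> proj_lines" by (simp add: axis_of_def)
  show "cubic_pt v \<notin> ?l" for v by (rule cubic_pt_not_in_inf_axis)
  have "{w. ?l \<subseteq> gamma w} = {None, Some t}"
    by (auto simp: inf_axis_subset_gamma[OF 3])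
  thus "card {w. ?l \<subseteq> gamma w} + ?n = CARD('a) + 1"
    using q by simp
  fix p assume p: "p \<in> proj_planes - Gamma_planes" and sub: "?l \<subseteq> p"
  hence "p \<in> proj_planes" by simp
  then obtain a b c d where pl: "p = plane a b c d" "a \<noteq> 0 \<or> b \<noteq> 0 \<or> c \<noteq> 0 \<or> d \<noteq> 0"
    by (rule proj_planeE)
  have "apolar t (- 1) 0 a b c d" using ax sub pl(1) by (simp add: axis_of_def)
  hence ap: "3 * t * a + b = 0" "- t * b - c = 0" by (simp_all add: apolar_def)
  have b: "b = - 3 * t * a" and c: "c = 3 * t\<^sup>2 * a" using ap by algebra+
  \<comment> \<open>The coefficient of \<open>y ^ 3\<close> left after subtracting
    \<open>a * (x - t * y) ^ 3\<close>; the second linear form is \<open>y\<close>, with its zero at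
    infinity.\<close>
  define \<beta> where "\<beta> = d + t ^ 3 * a"
  have d: "d = \<beta> - t ^ 3 * a" by (simp add: \<beta>_def)
  have form: "cubic_form a b c d x y = a * (x - t * y) ^ 3 + \<beta> * y ^ 3" for x y
    unfolding cubic_form_def b c d by algebra
  have "a \<noteq> 0"
    using p pl b c osculating_plane_infI[of d] by auto
  moreover have "\<beta> \<noteq> 0"
  proof
    assume "\<beta> = 0"
    hence "plane a b c d \<in> Gamma_planes"
      using \<open>a \<noteq> 0\<close> b c d by (intro osculating_planeI[of a _ _ t]) auto
    thus False using p pl(1) by simp
  qed
  moreover define L1 where "L1 = (\<lambda>v. 1 * id (hx v) + (- t) * id (hy v))"
  moreover define L2 where "L2 = (\<lambda>v. 0 * id (hx v) + 1 * id (hy v) :: 'a)"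
  moreover have "v \<in> {v. cubic_pt v \<in> p} \<longleftrightarrow> a * L1 v ^ 3 + \<beta> * L2 v ^ 3 = 0" for v
    by (simp add: pl cubic_pt_in_plane form L1_def L2_def)
  moreover have "card {v. L1 v \<noteq> 0 \<and> L2 v \<noteq> 0} = ?n"
  proof -
    have "L1 v = 0 \<longleftrightarrow> v = Some t" "L2 v = 0 \<longleftrightarrow> v = None" for v
      by (cases v; auto simp: L1_def L2_def)+
    hence "{v. L1 v \<noteq> 0 \<and> L2 v \<noteq> 0} = UNIV - {None, Some t}" by auto
    thus ?thesis by (simp add: card_Diff_subset card_option_finite)
  qed
  moreover have "L1 v ^ ?n = L2 v ^ ?n" if "L1 v \<noteq> 0" "L2 v \<noteq> 0" for v
    using that finite_field_power_card by metis
  ultimately show "3 dvd ?n \<Longrightarrow> card {v. cubic_pt v \<in> p} \<in> {0, 3}"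
    and "\<not> 3 dvd ?n \<Longrightarrow> card {v. cubic_pt v \<in> p} \<le> 1"
    using card_roots_sum_of_cubes[of id 1 1 0 "- t" L1 L2 "{v. cubic_pt v \<in> p}" a \<beta> ?n] q
    by simp_all
qed

lemma axis_order_RA:
  fixes l :: "('a::{field,finite} ^ 4) set"
  assumes 3: "(3::'a) \<noteq> 0" and q: "CARD('a) > 1" and "l \<in> RA_lines"
  shows "axis_order l (CARD('a) - 1)"
  using assms(3) axis_order_fin_axis_real[OF 3 _ q] axis_order_inf_axis[OF 3 q]
  by (auto simp: RA_lines_eq)

context quadratic_extension
begin

text \<open>The parameters are \<open>s\<close> and its conjugate \<open>t\<close>. The Frobenius
  map exchanges \<open>L1 v\<close> and \<open>L2 v\<close> at every rational \<open>v\<close>, so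
  both have the \<open>(q + 1)\<close>-th power \<open>L1 v * L2 v\<close>; neither vanishes, so all
  \<open>q + 1\<close> parameters remain.\<close>

lemma axis_order_IA:
  assumes 3: "(3::'a) \<noteq> 0" and l: "l \<in> IA_lines \<iota>"
  shows "axis_order l (CARD('a) + 1)"
  unfolding axis_order_def
proof (intro conjI allI ballI impI)
  let ?n = "CARD('a) + 1"
  obtain T N where lTN: "l = fin_axis T N" and nr: "\<And>x. x\<^sup>2 - T * x + N \<noteq> 0"
    using l IA_lines_eq[OF 3] by blast
  obtain s where s: "s \<notin> range \<iota>" "s\<^sup>2 - \<iota> T * s + \<iota> N = 0" using quadratic_splits[OF nr] .
  define t where "t = s ^ CARD('a)"
  have st: "s \<noteq> t" and T: "\<iota> T = s + t" and N: "\<iota> N = s * t"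
    using conjugate[OF s] by (simp_all add: t_def)
  have t: "t \<notin> range \<iota>"
  proof
    assume "t \<in> range \<iota>"
    then obtain x where "t = \<iota> x" by blast
    hence "s = \<iota> (T - x)" using T by (simp add: emb_simps)
    thus False using s by blast
  qed
  have neg: "(- z) ^ CARD('a) = - (z ^ CARD('a))" for z :: 'b
    using emb_pow_card[of "- 1"] power_mult_distrib[of "- 1" z "CARD('a)"] by (simp add: emb_simps)
  have t_pow: "t ^ CARD('a) = s"
  proof -
    have "t = - s + \<iota> T" by (simp add: T)
    hence "t ^ CARD('a) = (- s) ^ CARD('a) + \<iota> T" by (metis pow_card_add)
    thus ?thesis by (simp add: neg T flip: t_def)
  qed
  have three: "(3::'b) \<noteq> 0" using 3 emb_eq_0_iff[of 3] by (simp add: emb_simps)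
  have ax: "axis_of l N (- T) 1" unfolding lTN by (rule axis_of_fin_axis[OF 3])
  thus "l \<in> proj_lines" by (simp add: axis_of_def)
  show "cubic_pt v \<notin> l" for v unfolding lTN using cubic_pt_in_fin_axis nr by metis
  have "{w. l \<subseteq> gamma w} = {}" using nr by (auto simp: fin_axis_subset_gamma[OF 3] lTN)
  thus "card {w. l \<subseteq> gamma w} + ?n = CARD('a) + 1" by (simp only: card.empty add_0)
  fix p assume "p \<in> proj_planes - Gamma_planes" and sub: "l \<subseteq> p"
  hence "p \<in> proj_planes" by simp
  then obtain a b c d where pl: "p = plane a b c d" "a \<noteq> 0 \<or> b \<noteq> 0 \<or> c \<noteq> 0 \<or> d \<noteq> 0"
    by (rule proj_planeE)
  have ap: "apolar N (- T) 1 a b c d" using ax sub pl(1) by (simp add: axis_of_def)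
  have ab0: "a \<noteq> 0 \<or> b \<noteq> 0"
  proof (rule ccontr)
    assume "\<not> (a \<noteq> 0 \<or> b \<noteq> 0)"
    hence "c = 0 \<and> 3 * d = 0" using ap by (auto simp: apolar_def)
    thus False using pl(2) 3 \<open>\<not> (a \<noteq> 0 \<or> b \<noteq> 0)\<close> by simp
  qed
  have "apolar (\<iota> N) (- \<iota> T) 1 (\<iota> a) (\<iota> b) (\<iota> c) (\<iota> d)"
  proof -
    have "\<iota> (3 * N * a - - T * b + 1 * c) = 0" "\<iota> (- N * b + - T * c - 3 * 1 * d) = 0"
      using ap by (auto simp: apolar_def emb_eq_0_iff)
    thus ?thesis by (simp add: apolar_def emb_simps)
  qed
  then obtain \<alpha> \<beta> where ab: "\<iota> a = \<alpha> + \<beta>" "\<iota> b = - 3 * (\<alpha> * s + \<beta> * t)"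
    and form: "\<And>x y. cubic_form (\<iota> a) (\<iota> b) (\<iota> c) (\<iota> d) x y = \<alpha> * (x - s * y) ^ 3 + \<beta> * (x - t * y) ^ 3"
    unfolding T N by (rule apolar_sum_of_cubes[OF three st]) blast
  \<comment> \<open>If one cube is missing, \<open>- b / (3 * a)\<close> is the parameter of the
    other, against the irrationality of \<open>s\<close> and \<open>t\<close>.\<close>
  have rational: "r \<in> range \<iota>" if "\<iota> b = - 3 * (\<iota> a * r)" for r
  proof -
    have "a \<noteq> 0" using that ab0 by (auto simp: emb_eq_0_iff emb_simps)
    hence "r = \<iota> (- b / (3 * a))" using that three by (simp add: emb_simps emb_eq_0_iff field_simps)
    thus ?thesis by blast
  qed
  have "\<alpha> \<noteq> 0" using rational[of t] ab t by auto
  moreover have "\<beta> \<noteq> 0" using rational[of s] ab s by auto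
  moreover define L1 where "L1 = (\<lambda>v. 1 * \<iota> (hx v) + (- s) * \<iota> (hy v))"
  moreover define L2 where "L2 = (\<lambda>v. 1 * \<iota> (hx v) + (- t) * \<iota> (hy v))"
  moreover have "v \<in> {v. cubic_pt v \<in> p} \<longleftrightarrow> \<alpha> * L1 v ^ 3 + \<beta> * L2 v ^ 3 = 0" for v
  proof -
    have "cubic_pt v \<in> p \<longleftrightarrow> \<iota> (cubic_form a b c d (hx v) (hy v)) = 0"
      by (simp add: pl cubic_pt_in_plane emb_eq_0_iff)
    also have "\<iota> (cubic_form a b c d (hx v) (hy v)) =
      cubic_form (\<iota> a) (\<iota> b) (\<iota> c) (\<iota> d) (\<iota> (hx v)) (\<iota> (hy v))"
      by (simp add: cubic_form_def emb_simps)
    finally show ?thesis by (simp add: form L1_def L2_def)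
  qed
  moreover have "card {v. L1 v \<noteq> 0 \<and> L2 v \<noteq> 0} = ?n"
  proof -
    have "L1 v \<noteq> 0" "L2 v \<noteq> 0" for v
      using s(1) t by (cases v; auto simp: L1_def L2_def emb_simps)+
    hence "{v. L1 v \<noteq> 0 \<and> L2 v \<noteq> 0} = UNIV" by auto
    thus ?thesis by (simp add: card_option_finite)
  qed
  moreover have "L1 v ^ ?n = L2 v ^ ?n" for v
  proof -
    have "L1 v ^ CARD('a) = L2 v"
    proof (cases v)
      case (Some u)
      have "(- s + \<iota> u) ^ CARD('a) = - t + \<iota> u" by (simp only: pow_card_add neg t_def)
      thus ?thesis using Some by (simp add: L1_def L2_def emb_simps)
    qed (simp add: L1_def L2_def emb_simps)
    moreover have "L2 v ^ CARD('a) = L1 v"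
    proof (cases v)
      case (Some u)
      have "(- t + \<iota> u) ^ CARD('a) = - s + \<iota> u" by (simp only: pow_card_add neg t_pow)
      thus ?thesis using Some by (simp add: L1_def L2_def emb_simps)
    qed (simp add: L1_def L2_def emb_simps)
    ultimately show ?thesis by (simp add: mult.commute)
  qed
  moreover have "inj \<iota>" by (auto simp: inj_def emb_eq_iff)
  ultimately show "3 dvd ?n \<Longrightarrow> card {v. cubic_pt v \<in> p} \<in> {0, 3}"
    and "\<not> 3 dvd ?n \<Longrightarrow> card {v. cubic_pt v \<in> p} \<le> 1"
    using card_roots_sum_of_cubes[of \<iota> 1 "- t" 1 "- s" L1 L2 "{v. cubic_pt v \<in> p}" \<alpha> \<beta> ?n] st
    by (simp_all add: emb_simps)
qed

end

section \<open>Axes in a plane\<close>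

lemma other_plane_through_line:
  fixes l :: "('a::{field,finite} ^ 4) set"
  assumes l: "l \<in> proj_lines" and x: "x \<notin> l"
  obtains p where "p \<in> proj_planes" "l \<subseteq> p" "x \<notin> p"
proof -
  have "2 \<le> card {p \<in> proj_planes. l \<subseteq> p}"
    using card_planes_through_line[OF l] card_mono[of "UNIV :: 'a set" "{0}"] by simp
  hence "\<not> card {p \<in> proj_planes. l \<subseteq> p} \<le> Suc 0" by simp
  then obtain p p' where "p \<in> proj_planes" "l \<subseteq> p" "p' \<in> proj_planes" "l \<subseteq> p'" "p \<noteq> p'"
    by (auto simp: card_le_Suc0_iff_eq)
  thus thesis using unique_plane_through[OF l x] that by blast
qed

text \<open>The Hessian determinant of the cubic form divided by 4, with the coefficients of
  \<open>y\<^sup>2\<close>, \<open>x * y\<close>, \<open>x\<^sup>2\<close> in the order of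
  \<open>A, B, C\<close> in \<open>apolar\<close>.\<close>

definition hess :: "'a::field \<Rightarrow> 'a \<Rightarrow> 'a \<Rightarrow> 'a \<Rightarrow> 'a \<times> 'a \<times> 'a" where
  "hess a b c d = (3 * b * d - c\<^sup>2, 9 * a * d - b * c, 3 * a * c - b\<^sup>2)"

text \<open>A form with vanishing Hessian is a cube: \<open>a\<close> and \<open>b\<close> give the
  parameter \<open>t\<close>, and two of the equations then fix \<open>c\<close> and
  \<open>d\<close>; \<open>a = 0\<close> leaves only \<open>y ^ 3\<close>.\<close>

lemma hess_zero_imp_Gamma:
  fixes a b c d :: "'a::field"
  assumes 3: "(3::'a) \<noteq> 0" and nz: "a \<noteq> 0 \<or> b \<noteq> 0 \<or> c \<noteq> 0 \<or> d \<noteq> 0"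
    and h: "hess a b c d = (0, 0, 0)"
  shows "plane a b c d \<in> Gamma_planes"
proof (cases "a = 0")
  case True
  hence "b = 0" using h by (simp add: hess_def)
  hence "c = 0" using h by (simp add: hess_def)
  thus ?thesis using True \<open>b = 0\<close> nz osculating_plane_infI[of d] by simp
next
  case False
  define t where "t = - b / (3 * a)"
  have b: "b = - 3 * t * a" using 3 False by (simp add: t_def)
  have h': "3 * b * d = c\<^sup>2" "9 * a * d = b * c" "3 * a * c = b\<^sup>2"
    using h by (simp_all add: hess_def)
  have "(3 * a) * (c - 3 * t\<^sup>2 * a) = 0" using h'(3) b by algebra
  hence c: "c = 3 * t\<^sup>2 * a" using 3 False by simp
  have "(3 * (3 * a)) * (d + t ^ 3 * a) = 0" using h'(2) b c by algebra
  hence "d + t ^ 3 * a = 0" using 3 False unfolding mult_eq_0_iff by blast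
  hence d: "d = - (t ^ 3) * a" by (simp add: eq_neg_iff_add_eq_0)
  show ?thesis using False b c d by (rule osculating_planeI[OF _ refl])
qed

text \<open>The two conditions in \<open>apolar\<close> are orthogonality to two vectors whose cross product is
  \<open>hess\<close>, so an apolar quadratic is determined up to a factor.\<close>
lemma apolar_hess:
  fixes a b c d :: "'a::field"
  assumes h: "hess a b c d = (h1, h2, h3)"
  shows "apolar h1 h2 h3 a b c d"
proof -
  have "h1 = 3 * b * d - c\<^sup>2" "h2 = 9 * a * d - b * c" "h3 = 3 * a * c - b\<^sup>2"
    using h by (simp_all add: hess_def)
  thus ?thesis unfolding apolar_def by algebra
qed

lemma apolar_proportional_hess:
  fixes a b c d :: "'a::field"
  assumes h: "hess a b c d = (h1, h2, h3)" "(h1, h2, h3) \<noteq> (0, 0, 0)"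
    and ap: "apolar A B C a b c d" and Q: "(A, B, C) \<noteq> (0, 0, 0)"
  obtains k where "k \<noteq> 0" "A = k * h1" "B = k * h2" "C = k * h3"
proof -
  have hh: "h1 = 3 * b * d - c\<^sup>2" "h2 = 9 * a * d - b * c" "h3 = 3 * a * c - b\<^sup>2"
    using h(1) by (simp_all add: hess_def)
  have e: "3 * A * a - B * b + C * c = 0" "- A * b + B * c - 3 * C * d = 0"
    using ap by (simp_all add: apolar_def)
  \<comment> \<open>The cross product of \<open>(A, B, C)\<close> with the Hessian, itself a cross
    product, expands into multiples of the two conditions \<open>e\<close>.\<close>
  have x: "A * h2 = B * h1" "A * h3 = C * h1" "B * h3 = C * h2"
    using e unfolding hh by algebra+
  have "\<exists>k. A = k * h1 \<and> B = k * h2 \<and> C = k * h3"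
  proof -
    consider "h1 \<noteq> 0" | "h2 \<noteq> 0" | "h3 \<noteq> 0" using h(2) by auto
    thus ?thesis
    proof cases
      case 1 thus ?thesis using x by (intro exI[of _ "A / h1"]) (simp add: field_simps)
    next
      case 2 thus ?thesis using x by (intro exI[of _ "B / h2"]) (simp add: field_simps)
    next
      case 3 thus ?thesis using x by (intro exI[of _ "C / h3"]) (simp add: field_simps)
    qed
  qed
  then obtain k where k: "A = k * h1" "B = k * h2" "C = k * h3" by blast
  hence "k \<noteq> 0" using Q by auto
  thus thesis using k that by blast
qed

lemma apolar_scale:
  assumes "k \<noteq> (0::'a::field)"
  shows "apolar (k * A) (k * B) (k * C) a b c d \<longleftrightarrow> apolar A B C a b c d"
proof -
  have "apolar (k * A) (k * B) (k * C) a b c d \<longleftrightarrow>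
    k * (3 * A * a - B * b + C * c) = 0 \<and> k * (- A * b + B * c - 3 * C * d) = 0"
    unfolding apolar_def by (simp add: algebra_simps)
  thus ?thesis using assms by (simp add: apolar_def)
qed

text \<open>Both triples are multiples of the Hessian of \<open>p\<close>, so both lines lie in the
  same planes. A plane through \<open>l'\<close> that misses a point of \<open>l\<close> would
  contradict this.\<close>

lemma axis_unique:
  fixes l l' :: "('a::{field,finite} ^ 4) set"
  assumes 3: "(3::'a) \<noteq> 0" and p: "p \<in> proj_planes - Gamma_planes"
    and l: "axis_of l A B C" "(A, B, C) \<noteq> (0, 0, 0)" "l \<subseteq> p"
    and l': "axis_of l' A' B' C'" "(A', B', C') \<noteq> (0, 0, 0)" "l' \<subseteq> p"
  shows "l \<subseteq> l'"
proof
  fix x assume x: "x \<in> l"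
  show "x \<in> l'"
  proof (rule ccontr)
    assume "x \<notin> l'"
    then obtain p' where p': "p' \<in> proj_planes" "l' \<subseteq> p'" "x \<notin> p'"
      using l'(1) by (auto simp: axis_of_def elim: other_plane_through_line)
    obtain a b c d where pl: "p = plane a b c d" and nz: "a \<noteq> 0 \<or> b \<noteq> 0 \<or> c \<noteq> 0 \<or> d \<noteq> 0"
      using p by (auto elim: proj_planeE)
    obtain e f g h where pl': "p' = plane e f g h" using p'(1) by (rule proj_planeE)
    obtain h1 h2 h3 where H: "hess a b c d = (h1, h2, h3)" by (metis prod_cases3)
    have H0: "(h1, h2, h3) \<noteq> (0, 0, 0)" using hess_zero_imp_Gamma[OF 3 nz] H p pl by auto
    have "apolar A B C a b c d" "apolar A' B' C' a b c d" using l l' pl by (auto simp: axis_of_def)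
    then obtain k k' where k: "k \<noteq> 0" "A = k * h1" "B = k * h2" "C = k * h3"
      and k': "k' \<noteq> 0" "A' = k' * h1" "B' = k' * h2" "C' = k' * h3"
      using apolar_proportional_hess[OF H H0] l(2) l'(2) by metis
    have "apolar A' B' C' e f g h" using p'(2) l'(1) pl' by (simp add: axis_of_def)
    hence "apolar A B C e f g h" using k k' by (simp add: apolar_scale)
    hence "l \<subseteq> p'" using l(1) pl' by (simp add: axis_of_def)
    thus False using x p'(3) by blast
  qed
qed

lemma fin_axis_has_form:
  assumes "(3::'a::field) \<noteq> 0"
  shows "\<exists>A B C. axis_of (fin_axis T N :: ('a ^ 4) set) A B C \<and> (A, B, C) \<noteq> (0, 0, 0)"
proof -
  have "(N, - T, 1 :: 'a) \<noteq> (0, 0, 0)" by simp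
  thus ?thesis using axis_of_fin_axis[OF assms] by blast
qed

lemma inf_axis_has_form:
  "\<exists>A B C. axis_of (inf_axis t :: ('a::field ^ 4) set) A B C \<and> (A, B, C) \<noteq> (0, 0, 0)"
proof -
  have "(t, - 1 :: 'a, 0) \<noteq> (0, 0, 0)" by simp
  thus ?thesis using axis_of_inf_axis by blast
qed

lemma RA_has_form:
  assumes "(3::'a::field) \<noteq> 0" "(l :: ('a ^ 4) set) \<in> RA_lines"
  shows "\<exists>A B C. axis_of l A B C \<and> (A, B, C) \<noteq> (0, 0, 0)"
  using assms(2) fin_axis_has_form[OF assms(1)] inf_axis_has_form by (auto simp: RA_lines_eq)

text \<open>The form is \<open>y\<^sup>2 * (c * x + d * y)\<close>, with a double root at
  infinity.\<close>

lemma card_two_roots_inf: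
  fixes c d :: "'a::field"
  assumes "c \<noteq> 0"
  shows "card {v. cubic_pt v \<in> plane 0 0 c d} = 2"
proof -
  have "c * u + d = 0 \<longleftrightarrow> u = - d / c" for u
    unfolding nonzero_eq_divide_eq[OF assms] by (metis eq_neg_iff_add_eq_0 mult.commute)
  hence "cubic_pt v \<in> plane 0 0 c d \<longleftrightarrow> v = None \<or> v = Some (- d / c)" for v
    by (cases v) (simp_all add: cubic_pt_in_plane cubic_form_def)
  hence "{v. cubic_pt v \<in> plane 0 0 c d} = {None, Some (- d / c)}" by blast
  thus ?thesis by simp
qed

text \<open>A form apolar to the square of a linear form is divisible by that square. A third root
  equal to \<open>s\<close> would make it a cube; for \<open>a = 0\<close> the third root is
  infinity.\<close>

lemma card_two_roots_fin:
  fixes a b c d s :: "'a::field"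
  assumes 3: "(3::'a) \<noteq> 0" and ap: "apolar (s\<^sup>2) (- (2 * s)) 1 a b c d"
    and nz: "a \<noteq> 0 \<or> b \<noteq> 0 \<or> c \<noteq> 0 \<or> d \<noteq> 0" and nG: "plane a b c d \<notin> Gamma_planes"
  shows "card {v. cubic_pt v \<in> plane a b c d} = 2"
proof -
  have e: "3 * s\<^sup>2 * a - - (2 * s) * b + 1 * c = 0" "- (s\<^sup>2) * b + - (2 * s) * c - 3 * 1 * d = 0"
    using ap unfolding apolar_def by blast+
  have c: "c = - 2 * s * b - 3 * s\<^sup>2 * a" using e by algebra
  have "3 * (d - s\<^sup>2 * b - 2 * s ^ 3 * a) = 0" using e by algebra
  hence d: "d = s\<^sup>2 * b + 2 * s ^ 3 * a" using 3 unfolding mult_eq_0_iff by (simp add: algebra_simps)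
  have form: "cubic_form a b c d x y = (x - s * y)\<^sup>2 * (a * x + (b + 2 * a * s) * y)" for x y
    unfolding cubic_form_def c d by algebra
  show ?thesis
  proof (cases "a = 0")
    case True
    hence "b \<noteq> 0" using nz c d by auto
    hence "cubic_pt v \<in> plane a b c d \<longleftrightarrow> v = None \<or> v = Some s" for v
      by (cases v) (simp_all only: cubic_pt_in_plane form h_simps, simp_all add: True)
    hence "{v. cubic_pt v \<in> plane a b c d} = {None, Some s}" by blast
    thus ?thesis by simp
  next
    case False
    define r where "r = - (b + 2 * a * s) / a"
    have r: "b + 2 * a * s = - (a * r)" using False by (simp add: r_def)
    have "r \<noteq> s"
    proof
      assume "r = s"
      with r have "b + 2 * a * s = - (a * s)" by simp
      hence b: "b = - 3 * s * a" by algebra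
      have "plane a b c d \<in> Gamma_planes"
      proof (rule osculating_planeI[OF False refl b])
        show "c = 3 * s\<^sup>2 * a" "d = - (s ^ 3) * a" unfolding c d b by algebra+
      qed
      thus False using nG by simp
    qed
    have "cubic_form a b c d x y = a * ((x - s * y)\<^sup>2 * (x - r * y))" for x y
      unfolding form r by (simp add: algebra_simps)
    hence "cubic_pt v \<in> plane a b c d \<longleftrightarrow> v = Some s \<or> v = Some r" for v
      using False by (cases v) (simp_all add: cubic_pt_in_plane)
    hence "{v. cubic_pt v \<in> plane a b c d} = {Some s, Some r}" by blast
    thus ?thesis using \<open>r \<noteq> s\<close> by simp
  qed
qed

text \<open>The Hessian is a nonzero apolar quadratic, so only its roots matter: two distinct ones
  give a real axis, none gives the second alternative, and a double root is excluded by
  \<open>two\<close>.\<close>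

lemma axis_in_plane_exists:
  fixes p :: "('a::field ^ 4) set"
  assumes 3: "(3::'a) \<noteq> 0" and p: "p \<in> proj_planes - Gamma_planes"
    and two: "card {v. cubic_pt v \<in> p} \<noteq> 2"
  obtains l where "l \<in> RA_lines" "l \<subseteq> p"
  | T N where "fin_axis T N \<subseteq> p" "\<And>x. x\<^sup>2 - T * x + N \<noteq> 0"
proof -
  obtain a b c d where pl: "p = plane a b c d" and nz: "a \<noteq> 0 \<or> b \<noteq> 0 \<or> c \<noteq> 0 \<or> d \<noteq> 0"
    using p by (auto elim: proj_planeE)
  obtain A B C where H: "hess a b c d = (A, B, C)" by (metis prod_cases3)
  have H0: "(A, B, C) \<noteq> (0, 0, 0)" using hess_zero_imp_Gamma[OF 3 nz] H p pl by auto
  have ap: "apolar A B C a b c d" using H by (rule apolar_hess)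
  show thesis
  proof (cases "C = 0")
    case C0: True
    show thesis
    proof (cases "B = 0")
      case True
      hence "a = 0" "b = 0" using C0 H0 3 ap by (auto simp: apolar_def)
      moreover from this have "c \<noteq> 0" using p pl nz osculating_plane_infI[of d] by auto
      ultimately show thesis using two pl card_two_roots_inf[of c d] by simp
    next
      case False
      have "apolar (- B * (- A / B)) (- B * - 1) (- B * 0) a b c d" using ap False C0 by simp
      hence "apolar (- A / B) (- 1) 0 a b c d" using False by (subst (asm) apolar_scale) auto
      hence "inf_axis (- A / B) \<subseteq> p" using axis_of_inf_axis[of "- A / B"] pl by (simp add: axis_of_def)
      moreover have "inf_axis (- A / B) \<in> RA_lines" unfolding RA_lines_eq by blast
      ultimately show thesis using that(1) by blast
    qed
  next
    case False
    define T N where "T = - B / C" and "N = A / C"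
    have "apolar (C * N) (C * - T) (C * 1) a b c d" using ap False by (simp add: T_def N_def)
    hence ap': "apolar N (- T) 1 a b c d" using False by (subst (asm) apolar_scale) auto
    hence sub: "fin_axis T N \<subseteq> p" using axis_of_fin_axis[OF 3, of T N] pl by (auto simp: axis_of_def)
    show thesis
    proof (cases "\<exists>s. s\<^sup>2 - T * s + N = 0")
      case False
      thus thesis using sub that(2) by blast
    next
      case True
      then obtain s where s: "s\<^sup>2 - T * s + N = 0" by blast
      define t where "t = T - s"
      have T: "T = s + t" and N: "N = s * t"
        using s by (simp_all add: t_def algebra_simps power2_eq_square)
      show thesis
      proof (cases "s = t")
        case True
        hence "apolar (s\<^sup>2) (- (2 * s)) 1 a b c d" using ap' by (simp add: T N power2_eq_square)
        hence "card {v. cubic_pt v \<in> p} = 2"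
          unfolding pl by (rule card_two_roots_fin[OF 3 _ nz]) (use p pl in auto)
        thus thesis using two by simp
      next
        case False
        hence "fin_axis T N \<in> RA_lines" by (auto simp: RA_lines_eq T N)
        thus thesis using sub that(1) by blast
      qed
    qed
  qed
qed

context quadratic_extension
begin

lemma unique_axis_in_plane:
  assumes 3: "(3::'a) \<noteq> 0" and p: "p \<in> proj_planes - Gamma_planes"
    and two: "card {v. cubic_pt v \<in> p} \<noteq> 2"
  shows "\<exists>!l. l \<in> RA_lines \<union> IA_lines \<iota> \<and> l \<subseteq> p"
proof (rule ex_ex1I)
  from axis_in_plane_exists[OF 3 p two] show "\<exists>l. l \<in> RA_lines \<union> IA_lines \<iota> \<and> l \<subseteq> p"
  proof cases
    case (2 T N)
    hence "fin_axis T N \<in> IA_lines \<iota>" by (auto simp: IA_lines_eq[OF 3])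
    thus ?thesis using 2(1) by blast
  qed blast
next
  have form: "\<exists>A B C. axis_of l A B C \<and> (A, B, C) \<noteq> (0, 0, 0)" if "l \<in> RA_lines \<union> IA_lines \<iota>" for l
    using that RA_has_form[OF 3] fin_axis_has_form[OF 3] IA_lines_eq[OF 3] by auto
  fix l l' assume "l \<in> RA_lines \<union> IA_lines \<iota> \<and> l \<subseteq> p" "l' \<in> RA_lines \<union> IA_lines \<iota> \<and> l' \<subseteq> p"
  thus "l = l'" using form[of l] form[of l'] axis_unique[OF 3 p] by (metis subset_antisym)
qed

lemma IA_lines_nonempty:
  assumes "(3::'a) \<noteq> 0"
  shows "IA_lines \<iota> \<noteq> {}"
proof -
  have "card (range \<iota>) \<le> CARD('a)" by (rule card_image_le) simp
  also have "\<dots> < CARD('b)"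
    unfolding ext_card using card_base_ge_2 by (simp add: power2_eq_square)
  finally obtain s where s: "s \<notin> range \<iota>" by (metis less_irrefl UNIV_eq_I)
  obtain T N where TN: "s\<^sup>2 - \<iota> T * s + \<iota> N = 0" using irrational_quadratic[OF s] .
  thus ?thesis using irrational_quadratic_no_root[OF s TN] IA_lines_eq[OF assms] by blast
qed

end

section \<open>From counts for single axes to \<Lambda> and \<Pi>\<close>

lemma RA_lines_nonempty: "RA_lines \<noteq> {}"
  by (auto simp: RA_lines_eq)

lemma Pi_avg_const:
  assumes "finite L" "L \<noteq> {}" "\<And>l. l \<in> L \<Longrightarrow> real (card {p \<in> P. l \<subseteq> p}) = r"
  shows "Pi_avg P L = r"
  using assms by (simp add: Pi_avg_def)

lemma is_LambdaI:
  assumes "P \<noteq> {}" "\<And>p. p \<in> P \<Longrightarrow> card {l \<in> L. l \<subseteq> p} = n"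
  shows "is_Lambda L P n"
  using assms by (auto simp: is_Lambda_def)

text \<open>Serves both residue classes of \<open>q\<close>: \<open>LA\<close> is the class of axes
  whose order is divisible by 3, \<open>LB\<close> the other. Counts are constant on each class,
  which makes the averages exact.\<close>

lemma Lambda_Pi_from_orders:
  fixes LA LB :: "('a::{field,finite} ^ 4) set set"
  assumes LA: "\<And>l. l \<in> LA \<Longrightarrow> axis_order l n" "LA \<noteq> {}" "3 dvd n" "n > 0"
    and LB: "\<And>l. l \<in> LB \<Longrightarrow> axis_order l m" "LB \<noteq> {}" "\<not> 3 dvd m" "m > 0"
    and unique: "\<And>p. p \<in> proj_planes - Gamma_planes \<Longrightarrow> card {v. cubic_pt v \<in> p} \<noteq> 2 \<Longrightarrow>
      \<exists>!l. l \<in> LA \<union> LB \<and> l \<subseteq> p"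
  shows "is_Lambda LA (C_planes 3) 1" "is_Lambda LA (C_planes 0) 1" "is_Lambda LB one_C_planes 1"
    "Pi_avg (C_planes 3) LA = real n / 3" "Pi_avg (C_planes 0) LA = 2 * real n / 3"
    "Pi_avg one_C_planes LB = real m"
    "is_Lambda LB (C_planes 3) 0" "Pi_avg (C_planes 3) LB = 0"
    "is_Lambda LB (C_planes 0) 0" "Pi_avg (C_planes 0) LB = 0"
    "is_Lambda LA one_C_planes 0" "Pi_avg one_C_planes LA = 0"
proof -
  have cA: "3 * card {p \<in> C_planes 3. l \<subseteq> p} = n" "3 * card {p \<in> C_planes 0. l \<subseteq> p} = 2 * n"
    "{p \<in> one_C_planes. l \<subseteq> p} = {}" if "l \<in> LA" for l
    using axis_order_counts[OF LA(1)[OF that]] LA(3) by blast+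
  have cB: "{p \<in> C_planes 3. l \<subseteq> p} = {}" "{p \<in> C_planes 0. l \<subseteq> p} = {}"
    "card {p \<in> one_C_planes. l \<subseteq> p} = m" if "l \<in> LB" for l
    using axis_order_counts[OF LB(1)[OF that]] LB(3) by blast+
  have ex: "\<exists>!l. l \<in> LA \<union> LB \<and> l \<subseteq> p" if "p \<in> C_planes 3 \<union> C_planes 0 \<union> one_C_planes" for p
  proof (rule unique)
    have "p \<in> Gamma_planes \<Longrightarrow> card {v. cubic_pt v \<in> p} = 1"
      unfolding Gamma_planes_eq using card_cubic_points_gamma by blast
    moreover have "p \<in> proj_planes" "p \<notin> Gamma_planes \<or> card {v. cubic_pt v \<in> p} \<noteq> 1"
      using that by (auto simp: C_planes_eq one_C_planes_def)
    ultimately show "p \<in> proj_planes - Gamma_planes" by blast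
    show "card {v. cubic_pt v \<in> p} \<noteq> 2"
      using that by (auto simp: C_planes_eq one_C_planes_def)
  qed
  \<comment> \<open>If no axis of \<open>L'\<close> lies in a plane of \<open>P\<close>, the unique
    axis in such a plane belongs to \<open>L\<close>.\<close>
  have one: "card {l \<in> L. l \<subseteq> p} = 1" "card {l \<in> L'. l \<subseteq> p} = 0"
    if "L \<union> L' = LA \<union> LB" "p \<in> P" "P \<subseteq> C_planes 3 \<union> C_planes 0 \<union> one_C_planes"
      and no: "\<And>l. l \<in> L' \<Longrightarrow> {p \<in> P. l \<subseteq> p} = {}" for L L' P p
  proof -
    have e: "{l \<in> L'. l \<subseteq> p} = {}" using no that(2) by blast
    thus "card {l \<in> L'. l \<subseteq> p} = 0" by (simp only: card.empty)
    have "\<exists>!l. l \<in> L \<union> L' \<and> l \<subseteq> p" unfolding that(1) by (rule ex) (use that in blast)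
    hence "\<exists>!l. l \<in> L \<and> l \<subseteq> p" using e by blast
    thus "card {l \<in> L. l \<subseteq> p} = 1" by (simp add: card_1_singleton_iff) blast
  qed
  obtain lA lB where l: "lA \<in> LA" "lB \<in> LB" using LA(2) LB(2) by blast
  \<comment> \<open>Positive counts through a single axis show that each plane type occurs, as
    \<open>is_Lambda\<close> demands.\<close>
  have "card {p \<in> C_planes 3. lA \<subseteq> p} \<noteq> 0" "card {p \<in> C_planes 0. lA \<subseteq> p} \<noteq> 0"
    "card {p \<in> one_C_planes. lB \<subseteq> p} \<noteq> 0"
    using cA(1,2)[OF l(1)] cB(3)[OF l(2)] LA(4) LB(4) by linarith+
  hence ne: "C_planes 3 \<noteq> ({} :: ('a ^ 4) set set)" "C_planes 0 \<noteq> ({} :: ('a ^ 4) set set)"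
    "one_C_planes \<noteq> ({} :: ('a ^ 4) set set)"
    by (auto simp: card_eq_0_iff)
  show "is_Lambda LA (C_planes 3) 1" by (intro is_LambdaI ne one(1)[of LA LB _ "C_planes 3"] cB) auto
  show "is_Lambda LA (C_planes 0) 1" by (intro is_LambdaI ne one(1)[of LA LB _ "C_planes 0"] cB) auto
  show "is_Lambda LB one_C_planes 1" by (intro is_LambdaI ne one(1)[of LB LA _ "one_C_planes"] cA) auto
  show "is_Lambda LB (C_planes 3) 0" by (intro is_LambdaI ne one(2)[of LA LB _ "C_planes 3"] cB) auto
  show "is_Lambda LB (C_planes 0) 0" by (intro is_LambdaI ne one(2)[of LA LB _ "C_planes 0"] cB) auto
  show "is_Lambda LA one_C_planes 0" by (intro is_LambdaI ne one(2)[of LB LA _ "one_C_planes"] cA) auto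
  show "Pi_avg (C_planes 3) LA = real n / 3"
  proof (intro Pi_avg_const LA(2))
    fix l assume "l \<in> LA"
    hence "real (3 * card {p \<in> C_planes 3. l \<subseteq> p}) = real n" by (simp only: cA(1))
    thus "real (card {p \<in> C_planes 3. l \<subseteq> p}) = real n / 3" by simp
  qed simp
  show "Pi_avg (C_planes 0) LA = 2 * real n / 3"
  proof (intro Pi_avg_const LA(2))
    fix l assume "l \<in> LA"
    hence "real (3 * card {p \<in> C_planes 0. l \<subseteq> p}) = real (2 * n)" by (simp only: cA(2))
    thus "real (card {p \<in> C_planes 0. l \<subseteq> p}) = 2 * real n / 3" by simp
  qed simp
  show "Pi_avg one_C_planes LB = real m" by (intro Pi_avg_const LB(2)) (simp_all add: cB)
  show "Pi_avg (C_planes 3) LB = 0"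
    by (intro Pi_avg_const LB(2)) (simp_all only: cB card.empty of_nat_0 finite)
  show "Pi_avg (C_planes 0) LB = 0"
    by (intro Pi_avg_const LB(2)) (simp_all only: cB card.empty of_nat_0 finite)
  show "Pi_avg one_C_planes LA = 0"
    by (intro Pi_avg_const LA(2)) (simp_all only: cA card.empty of_nat_0 finite)
qed

theorem theorem5p8:
  fixes \<iota> :: "'a::{field,finite} \<Rightarrow> 'b::{field,finite}" and q :: nat
  assumes q_def: "q = CARD('a)"
    and q_ge: "q \<ge> 5"
    and q_mod: "q mod 3 \<noteq> 0"
    and ext_card: "CARD('b) = q ^ 2"
    and emb_one: "\<iota> 1 = 1"
    and emb_add: "\<And>x y. \<iota> (x + y) = \<iota> x + \<iota> y"
    and emb_mult: "\<And>x y. \<iota> (x * y) = \<iota> x * \<iota> y"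
  defines "RA \<equiv> RA_lines :: ('a ^ 4) set set"
    and "IA \<equiv> IA_lines \<iota>"
    and "P3 \<equiv> C_planes 3 :: ('a ^ 4) set set"
    and "P0 \<equiv> C_planes 0 :: ('a ^ 4) set set"
    and "P1 \<equiv> one_C_planes :: ('a ^ 4) set set"
  shows "(q mod 3 = 1 \<longrightarrow>
            is_Lambda RA P3 1 \<and> is_Lambda RA P0 1 \<and> is_Lambda IA P1 1 \<and>
            Pi_avg P3 RA = (real q - 1) / 3 \<and>
            Pi_avg P0 RA = 2 * (real q - 1) / 3 \<and>
            Pi_avg P1 IA = real q + 1 \<and>
            is_Lambda IA P3 0 \<and> Pi_avg P3 IA = 0 \<and>
            is_Lambda IA P0 0 \<and> Pi_avg P0 IA = 0 \<and>
            is_Lambda RA P1 0 \<and> Pi_avg P1 RA = 0) \<and>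
         (q mod 3 = 2 \<longrightarrow>
            is_Lambda IA P3 1 \<and> is_Lambda IA P0 1 \<and> is_Lambda RA P1 1 \<and>
            Pi_avg P3 IA = (real q + 1) / 3 \<and>
            Pi_avg P0 IA = 2 * (real q + 1) / 3 \<and>
            Pi_avg P1 RA = real q - 1 \<and>
            is_Lambda RA P3 0 \<and> Pi_avg P3 RA = 0 \<and>
            is_Lambda RA P0 0 \<and> Pi_avg P0 RA = 0 \<and>
            is_Lambda IA P1 0 \<and> Pi_avg P1 IA = 0)"
proof -
  interpret quadratic_extension \<iota>
    by unfold_locales (use ext_card emb_one emb_add emb_mult q_def in auto)
  have three: "(3::'a) \<noteq> 0" using q_mod q_def by (intro three_neq_zero) simp
  have orders: "axis_order l (q - 1)" if "l \<in> RA" for l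
    using that axis_order_RA[OF three] q_ge by (simp add: RA_def q_def)
  have orders': "axis_order l (q + 1)" if "l \<in> IA" for l
    using that axis_order_IA[OF three] by (simp add: IA_def q_def)
  have ne: "RA \<noteq> {}" "IA \<noteq> {}"
    using RA_lines_nonempty IA_lines_nonempty[OF three] by (simp_all add: RA_def IA_def)
  have pos: "q - 1 > 0" "q + 1 > 0" and r: "real (q - 1) = real q - 1" "real (q + 1) = real q + 1"
    using q_ge by auto
  note unique = unique_axis_in_plane[OF three, folded RA_def IA_def]
  show ?thesis
  proof (intro conjI[of "_ \<longrightarrow> _" "_ \<longrightarrow> _"] impI)
    assume "q mod 3 = 1"
    \<comment> \<open>Divisibility by 3 decides which class of axes takes the role of
      \<open>LA\<close>.\<close>
    hence d: "3 dvd q - 1" "\<not> 3 dvd q + 1" using q_ge by presburger+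
    note * = Lambda_Pi_from_orders[OF orders ne(1) d(1) pos(1) orders' ne(2) d(2) pos(2) unique,
        folded P3_def P0_def P1_def, unfolded r]
    show "is_Lambda RA P3 1 \<and> is_Lambda RA P0 1 \<and> is_Lambda IA P1 1 \<and>
            Pi_avg P3 RA = (real q - 1) / 3 \<and>
            Pi_avg P0 RA = 2 * (real q - 1) / 3 \<and>
            Pi_avg P1 IA = real q + 1 \<and>
            is_Lambda IA P3 0 \<and> Pi_avg P3 IA = 0 \<and>
            is_Lambda IA P0 0 \<and> Pi_avg P0 IA = 0 \<and>
            is_Lambda RA P1 0 \<and> Pi_avg P1 RA = 0"
      by (intro conjI *)
  next
    assume "q mod 3 = 2"
    hence d: "\<not> 3 dvd q - 1" "3 dvd q + 1" using q_ge by presburger+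
    note * = Lambda_Pi_from_orders[OF orders' ne(2) d(2) pos(2) orders ne(1) d(1) pos(1)
        unique[unfolded Un_commute[of RA IA]], folded P3_def P0_def P1_def, unfolded r]
    show "is_Lambda IA P3 1 \<and> is_Lambda IA P0 1 \<and> is_Lambda RA P1 1 \<and>
            Pi_avg P3 IA = (real q + 1) / 3 \<and>
            Pi_avg P0 IA = 2 * (real q + 1) / 3 \<and>
            Pi_avg P1 RA = real q - 1 \<and>
            is_Lambda RA P3 0 \<and> Pi_avg P3 RA = 0 \<and>
            is_Lambda RA P0 0 \<and> Pi_avg P0 RA = 0 \<and>
            is_Lambda IA P1 0 \<and> Pi_avg P1 IA = 0"
      by (intro conjI *)
  qed
qed

end
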